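(* Let $\alpha\in(0,1)$ and $q>\frac{2N}{\alpha}$. Let $\Omega$ be a bounded Lipschitz domain in $\mathbb{R}^N$ and $\varphi\in C^{0,\alpha}(\partial\Omega)$. Let $p$ run through a sequence of exponents $p>\frac{2N}{\alpha}$ increasing to $+\infty$. Then: (i) $\Gamma(L^q(\Omega))\text{-}\lim_{p\to+\infty}E^{\varphi}_{\alpha,p}=\overline{E}^{\varphi}_{\alpha,\infty}$. (ii) Let $u_p$ be a minimizer of $E^{\varphi}_{\alpha,p}$ for each $p$. If $u_p\to u$ strongly in $L^q(\Omega)$ and $\Gamma(L^q(\Omega))\text{-}\lim_{p\to+\infty}E^{\varphi}_{\alpha,p}=\overline{E}^{\varphi}_{\alpha,\infty}$, then $u$ is a minimizer of $\overline{E}^{\varphi}_{\alpha,\infty}$ in $X^{\varphi}_{\alpha,\infty}(\overline\Omega)$.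
   Context: A domain is a connected open set. For $p>2N/\alpha$, $$X^{\varphi}_{\alpha,p}(\Omega)=\Big\{u:\Big(\int_{\Omega\times\Omega}\tfrac{|u(x)-u(y)|^p}{|x-y|^{\alpha p}}\,dx\,dy\Big)^{1/p}<\infty,\ u=\varphi\text{ on }\partial\Omega\Big\},$$ $$X^{\varphi}_{\alpha,\infty}(\overline\Omega)=\Big\{u:\sup_{x,y\in\overline\Omega,\,x\neq y}\tfrac{|u(x)-u(y)|}{|x-y|^{\alpha}}<\infty,\ u=\varphi\text{ on }\partial\Omega\Big\}.$$ Functions are identified up to null sets. For $p>2N/\alpha$, a function with finite energy has a representative that extends continuously to $\overline\Omega$. Boundary values and suprema over $\overline\Omega$ refer to this continuous representative on $\overline\Omega$. The functionals $E^{\varphi}_{\alpha,p},\overline{E}^{\varphi}_{\alpha,\infty}:L^q(\Omega)\to[0,\infty]$ are $$E^{\varphi}_{\alpha,p}(u)=\Big(\int_{\Omega\times\Omega}\tfrac{|u(x)-u(y)|^p}{|x-y|^{\alpha p}}\,dx\,dy\Big)^{1/p}\text{ if }u\in X^{\varphi}_{\alpha,p}(\Omega),\quad \infty\text{ otherwise};$$ $$\overline{E}^{\varphi}_{\alpha,\infty}(u)=\sup_{x,y\in\overline\Omega,\,x\neq y}\tfrac{|u(x)-u(y)|}{|x-y|^{\alpha}}\text{ if }u\in X^{\varphi}_{\alpha,\infty}(\overline\Omega),\quad\infty\text{ otherwise}.$$ $\Gamma$-convergence: for a metric space $X$, functionals $E_n:X\to\mathbb{R}\cup\{\infty\}$ $\Gamma(X)$-converge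 to $E:X\to\mathbb{R}\cup\{\infty\}$ if (a) for every $u\in X$ and every $u_n\to u$ in $X$, $E(u)\le\liminf_n E_n(u_n)$; and (b) for every $u\in X$ there is a sequence $u_n\to u$ in $X$ with $E(u)\ge\limsup_n E_n(u_n)$. Here $X=L^q(\Omega)$ with its norm metric. *)

theory Defs
  imports "HOL-Analysis.Analysis"
begin

section \<open>Bounded Lipschitz domains\<close>

text \<open>Near each boundary point the set is the open region above the graph of a Lipschitz function,
  in a rotated coordinate system. The rotation is encoded by the unit vector \<open>e\<close> of the last
  coordinate axis: \<open>x \<bullet> e\<close> is the last coordinate, and the remaining coordinates
  are the orthogonal projection of \<open>x\<close> to the hyperplane orthogonal to \<open>e\<close>.\<close>

definition lipschitz_boundary :: "'a::euclidean_space set \<Rightarrow> bool" where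
  "lipschitz_boundary \<Omega> \<longleftrightarrow>
     (\<forall>x0\<in>frontier \<Omega>. \<exists>r>0. \<exists>e C \<gamma>. norm e = 1 \<and> lipschitz_on C {y. y \<bullet> e = 0} \<gamma> \<and>
        \<Omega> \<inter> ball x0 r = {x \<in> ball x0 r. \<gamma> (x - (x \<bullet> e) *\<^sub>R e) < x \<bullet> e})"

definition bounded_lipschitz_domain :: "'a::euclidean_space set \<Rightarrow> bool" where
  "bounded_lipschitz_domain \<Omega> \<longleftrightarrow> open \<Omega> \<and> connected \<Omega> \<and> bounded \<Omega> \<and> lipschitz_boundary \<Omega>"


section \<open>Functions up to null sets and the metric space \<open>L\<^sup>q(\<Omega>)\<close>\<close>

text \<open>Functions are total on the ambient space; the values outside \<open>\<Omega>\<close> are irrelevant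
  for the equivalence relation.\<close>

definition ae_eq :: "'a::euclidean_space set \<Rightarrow> (('a \<Rightarrow> real) \<times> ('a \<Rightarrow> real)) set" where
  "ae_eq \<Omega> = {(u, v). u \<in> borel_measurable (lebesgue_on \<Omega>) \<and> v \<in> borel_measurable (lebesgue_on \<Omega>) \<and>
                      (AE x in lebesgue_on \<Omega>. u x = v x)}"

definition L0 :: "'a::euclidean_space set \<Rightarrow> ('a \<Rightarrow> real) set set" where
  "L0 \<Omega> = borel_measurable (lebesgue_on \<Omega>) // ae_eq \<Omega>"

definition Lq_functions :: "real \<Rightarrow> 'a::euclidean_space set \<Rightarrow> ('a \<Rightarrow> real) set" where
  "Lq_functions q \<Omega> = {u \<in> borel_measurable (lebesgue_on \<Omega>).
                         integrable (lebesgue_on \<Omega>) (\<lambda>x. \<bar>u x\<bar> powr q)}"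

definition Lq :: "real \<Rightarrow> 'a::euclidean_space set \<Rightarrow> ('a \<Rightarrow> real) set set" where
  "Lq q \<Omega> = Lq_functions q \<Omega> // ae_eq \<Omega>"

definition rep :: "('a::euclidean_space \<Rightarrow> real) set \<Rightarrow> 'a \<Rightarrow> real" where
  "rep U = (SOME u. u \<in> U)"

definition Lq_norm :: "real \<Rightarrow> 'a::euclidean_space set \<Rightarrow> ('a \<Rightarrow> real) \<Rightarrow> real" where
  "Lq_norm q \<Omega> u = (LINT x|lebesgue_on \<Omega>. \<bar>u x\<bar> powr q) powr (1 / q)"

definition Lq_dist :: "real \<Rightarrow> 'a::euclidean_space set \<Rightarrow> ('a \<Rightarrow> real) set \<Rightarrow> ('a \<Rightarrow> real) set \<Rightarrow> real" where
  "Lq_dist q \<Omega> U V = Lq_norm q \<Omega> (\<lambda>x. rep U x - rep V x)"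

text \<open>A genuine metric space for \<open>1 \<le> q\<close>, see \<open>Metric_space_Lq\<close> below.\<close>

definition Lq_metric :: "real \<Rightarrow> 'a::euclidean_space set \<Rightarrow> ('a \<Rightarrow> real) set metric" where
  "Lq_metric q \<Omega> = metric (Lq q \<Omega>, Lq_dist q \<Omega>)"


section \<open>Energies and function spaces\<close>

definition ennreal_root :: "real \<Rightarrow> ennreal \<Rightarrow> ennreal" where
  "ennreal_root p I = (if I = \<infinity> then \<infinity> else ennreal (enn2real I powr (1 / p)))"

text \<open>On the diagonal, a null set, the integrand is \<open>0 / 0 = 0\<close>.\<close>

definition frac_seminorm :: "real \<Rightarrow> real \<Rightarrow> 'a::euclidean_space set \<Rightarrow> ('a \<Rightarrow> real) \<Rightarrow> ennreal" where
  "frac_seminorm \<alpha> p \<Omega> u = ennreal_root p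
     (\<integral>\<^sup>+(x, y). ennreal (\<bar>u x - u y\<bar> powr p / norm (x - y) powr (\<alpha> * p))
        \<partial>(lebesgue_on \<Omega> \<Otimes>\<^sub>M lebesgue_on \<Omega>))"

definition holder_seminorm :: "real \<Rightarrow> 'a::euclidean_space set \<Rightarrow> ('a \<Rightarrow> real) \<Rightarrow> ennreal" where
  "holder_seminorm \<alpha> S u =
     (SUP (x, y)\<in>{(x, y). x \<in> S \<and> y \<in> S \<and> x \<noteq> y}. ennreal (\<bar>u x - u y\<bar> / norm (x - y) powr \<alpha>))"

text \<open>\<open>C\<^sup>0\<^sup>,\<^sup>\<alpha>(S)\<close>\<close>

definition holder_space :: "real \<Rightarrow> 'a::euclidean_space set \<Rightarrow> ('a \<Rightarrow> real) set" where
  "holder_space \<alpha> S = {f. bounded (f ` S) \<and> holder_seminorm \<alpha> S f < \<infinity>}"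

text \<open>The members of a class that are continuous up to the boundary. When \<open>\<Omega>\<close> is open, any two
  agree on the closure (\<open>cont_reps_unique\<close> below), so \<open>cont_rep\<close> is the continuous representative
  whenever there is one.\<close>

definition cont_reps :: "'a::euclidean_space set \<Rightarrow> ('a \<Rightarrow> real) set \<Rightarrow> ('a \<Rightarrow> real) set" where
  "cont_reps \<Omega> U = {v \<in> U. continuous_on (closure \<Omega>) v}"

definition cont_rep :: "'a::euclidean_space set \<Rightarrow> ('a \<Rightarrow> real) set \<Rightarrow> 'a \<Rightarrow> real" where
  "cont_rep \<Omega> U = (SOME v. v \<in> cont_reps \<Omega> U)"

definition has_boundary_values :: "'a::euclidean_space set \<Rightarrow> ('a \<Rightarrow> real) \<Rightarrow> ('a \<Rightarrow> real) set \<Rightarrow> bool" where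
  "has_boundary_values \<Omega> \<phi> U \<longleftrightarrow> cont_reps \<Omega> U \<noteq> {} \<and> (\<forall>x\<in>frontier \<Omega>. cont_rep \<Omega> U x = \<phi> x)"

text \<open>The energy of a class does not depend on the choice of its representative
  (\<open>frac_seminorm_cong_AE\<close> below).\<close>

definition X_p :: "real \<Rightarrow> real \<Rightarrow> 'a::euclidean_space set \<Rightarrow> ('a \<Rightarrow> real) \<Rightarrow> ('a \<Rightarrow> real) set set" where
  "X_p \<alpha> p \<Omega> \<phi> = {U \<in> L0 \<Omega>. frac_seminorm \<alpha> p \<Omega> (rep U) < \<infinity> \<and> has_boundary_values \<Omega> \<phi> U}"

definition X_inf :: "real \<Rightarrow> 'a::euclidean_space set \<Rightarrow> ('a \<Rightarrow> real) \<Rightarrow> ('a \<Rightarrow> real) set set" where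
  "X_inf \<alpha> \<Omega> \<phi> = {U \<in> L0 \<Omega>. has_boundary_values \<Omega> \<phi> U \<and>
                              holder_seminorm \<alpha> (closure \<Omega>) (cont_rep \<Omega> U) < \<infinity>}"

definition E_p :: "real \<Rightarrow> real \<Rightarrow> 'a::euclidean_space set \<Rightarrow> ('a \<Rightarrow> real) \<Rightarrow> ('a \<Rightarrow> real) set \<Rightarrow> ennreal" where
  "E_p \<alpha> p \<Omega> \<phi> U = (if U \<in> X_p \<alpha> p \<Omega> \<phi> then frac_seminorm \<alpha> p \<Omega> (rep U) else \<infinity>)"

definition E_inf :: "real \<Rightarrow> 'a::euclidean_space set \<Rightarrow> ('a \<Rightarrow> real) \<Rightarrow> ('a \<Rightarrow> real) set \<Rightarrow> ennreal" where
  "E_inf \<alpha> \<Omega> \<phi> U =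
     (if U \<in> X_inf \<alpha> \<Omega> \<phi> then holder_seminorm \<alpha> (closure \<Omega>) (cont_rep \<Omega> U) else \<infinity>)"


section \<open>\<open>\<Gamma>\<close>-convergence\<close>

text \<open>The codomain is polymorphic, so that both \<^typ>\<open>ereal\<close> and \<^typ>\<open>ennreal\<close> are covered.\<close>

definition Gamma_converges ::
    "'a metric \<Rightarrow> (nat \<Rightarrow> 'a \<Rightarrow> 'b::complete_linorder) \<Rightarrow> ('a \<Rightarrow> 'b) \<Rightarrow> bool" where
  "Gamma_converges m F E \<longleftrightarrow>
     (\<forall>u\<in>mspace m. \<forall>s. range s \<subseteq> mspace m \<longrightarrow> limitin (mtopology_of m) s u sequentially \<longrightarrow>
        E u \<le> liminf (\<lambda>n. F n (s n))) \<and>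
     (\<forall>u\<in>mspace m. \<exists>s. range s \<subseteq> mspace m \<and> limitin (mtopology_of m) s u sequentially \<and>
        limsup (\<lambda>n. F n (s n)) \<le> E u)"


section \<open>Well-definedness\<close>

lemma equiv_ae_eq: "equiv (borel_measurable (lebesgue_on \<Omega>)) (ae_eq \<Omega>)"
proof (rule equivI)
  show "ae_eq \<Omega> \<subseteq> borel_measurable (lebesgue_on \<Omega>) \<times> borel_measurable (lebesgue_on \<Omega>)"
    by (auto simp: ae_eq_def)
  show "refl_on (borel_measurable (lebesgue_on \<Omega>)) (ae_eq \<Omega>)"
    by (auto simp: ae_eq_def refl_on_def)
  show "sym (ae_eq \<Omega>)"
    by (auto simp: ae_eq_def sym_def)
  show "trans (ae_eq \<Omega>)"
    unfolding trans_def ae_eq_def by auto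
qed

lemma rep_in:
  assumes "U \<in> L0 \<Omega>"
  shows "rep U \<in> U"
proof -
  have "U \<noteq> {}" using assms in_quotient_imp_non_empty[OF equiv_ae_eq] by (auto simp: L0_def)
  then show ?thesis unfolding rep_def by (simp add: some_in_eq)
qed

lemma L0_ae_eq: "U \<in> L0 \<Omega> \<Longrightarrow> u \<in> U \<Longrightarrow> v \<in> U \<Longrightarrow> (u, v) \<in> ae_eq \<Omega>"
  using in_quotient_imp_in_rel[OF equiv_ae_eq, of U \<Omega> u v] by (auto simp: L0_def)

lemma L0_measurable: "U \<in> L0 \<Omega> \<Longrightarrow> u \<in> U \<Longrightarrow> u \<in> borel_measurable (lebesgue_on \<Omega>)"
  using L0_ae_eq[of U \<Omega> u u] by (auto simp: ae_eq_def)

lemma Lq_subset_L0: "Lq q \<Omega> \<subseteq> L0 \<Omega>"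
  by (auto simp: Lq_def L0_def Lq_functions_def quotient_def)

lemma Lq_functions_ae_eq:
  assumes "u \<in> Lq_functions q \<Omega>" "(u, v) \<in> ae_eq \<Omega>"
  shows "v \<in> Lq_functions q \<Omega>"
proof -
  have [measurable]: "u \<in> borel_measurable (lebesgue_on \<Omega>)" "v \<in> borel_measurable (lebesgue_on \<Omega>)"
    and ae: "AE x in lebesgue_on \<Omega>. u x = v x"
    using assms by (auto simp: ae_eq_def)
  have "integrable (lebesgue_on \<Omega>) (\<lambda>x. \<bar>v x\<bar> powr q) \<longleftrightarrow> integrable (lebesgue_on \<Omega>) (\<lambda>x. \<bar>u x\<bar> powr q)"
    by (rule integrable_cong_AE) (use ae in auto)
  then show ?thesis using assms(1) by (auto simp: Lq_functions_def)
qed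

lemma Lq_member:
  assumes "U \<in> Lq q \<Omega>" "u \<in> U"
  shows "u \<in> Lq_functions q \<Omega>"
proof -
  obtain w where "w \<in> Lq_functions q \<Omega>" "U = ae_eq \<Omega> `` {w}"
    using assms(1) by (auto simp: Lq_def quotient_def)
  with assms(2) show ?thesis using Lq_functions_ae_eq by auto
qed

lemma Lq_norm_nonneg: "0 \<le> Lq_norm q \<Omega> u"
  by (simp add: Lq_norm_def)

lemma Lq_norm_cong_AE:
  assumes "u \<in> borel_measurable (lebesgue_on \<Omega>)" "v \<in> borel_measurable (lebesgue_on \<Omega>)"
    and "AE x in lebesgue_on \<Omega>. u x = v x"
  shows "Lq_norm q \<Omega> u = Lq_norm q \<Omega> v"
proof -
  have [measurable]: "u \<in> borel_measurable (lebesgue_on \<Omega>)" "v \<in> borel_measurable (lebesgue_on \<Omega>)"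
    using assms by auto
  have "(LINT x|lebesgue_on \<Omega>. \<bar>u x\<bar> powr q) = (LINT x|lebesgue_on \<Omega>. \<bar>v x\<bar> powr q)"
    by (rule integral_cong_AE) (use assms(3) in auto)
  then show ?thesis by (simp add: Lq_norm_def)
qed

lemma Lq_norm_eq_0_iff:
  assumes "u \<in> Lq_functions q \<Omega>"
  shows "Lq_norm q \<Omega> u = 0 \<longleftrightarrow> (AE x in lebesgue_on \<Omega>. u x = 0)"
proof -
  have "integral\<^sup>L (lebesgue_on \<Omega>) (\<lambda>x. \<bar>u x\<bar> powr q) = 0 \<longleftrightarrow>
        (AE x in lebesgue_on \<Omega>. \<bar>u x\<bar> powr q = 0)"
    by (rule integral_nonneg_eq_0_iff_AE) (use assms in \<open>auto simp: Lq_functions_def\<close>)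
  then show ?thesis by (simp add: Lq_norm_def)
qed

lemma powr_convex_nonneg:
  fixes a b s t q :: real
  assumes "1 \<le> q" "0 \<le> a" "0 \<le> b" "0 < s" "0 < t" "s + t = 1"
  shows "(s * a + t * b) powr q \<le> s * a powr q + t * b powr q"
proof -
  have le: "c powr q \<le> c" if "0 < c" "c \<le> 1" for c :: real
    using powr_mono'[of 1 q c] that assms(1) by auto
  consider "a = 0" | "b = 0" | "0 < a" "0 < b" using assms by linarith
  then show ?thesis
  proof cases
    case 1
    have "(t * b) powr q = t powr q * b powr q" using assms by (simp add: powr_mult)
    also have "\<dots> \<le> t * b powr q" using le[of t] assms by (intro mult_right_mono) auto
    finally show ?thesis using 1 assms by simp
  next
    case 2
    have "(s * a) powr q = s powr q * a powr q" using assms by (simp add: powr_mult)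
    also have "\<dots> \<le> s * a powr q" using le[of s] assms by (intro mult_right_mono) auto
    finally show ?thesis using 2 assms by simp
  next
    case 3
    have "convex_on {0<..} (\<lambda>x::real. x powr q)" using powr_convex[OF assms(1)] .
    from convex_onD[OF this, of t a b] 3 assms
    have "((1 - t) * a + t * b) powr q \<le> (1 - t) * a powr q + t * b powr q" by simp
    moreover have "1 - t = s" using assms by simp
    ultimately show ?thesis by simp
  qed
qed

lemma Lq_functions_norm_powr:
  assumes "0 < q"
  shows "(LINT x|lebesgue_on \<Omega>. \<bar>u x\<bar> powr q) = Lq_norm q \<Omega> u powr q"
proof -
  have "0 \<le> (LINT x|lebesgue_on \<Omega>. \<bar>u x\<bar> powr q)" by simp
  then show ?thesis using assms by (simp add: Lq_norm_def powr_powr)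
qed

lemma Lq_minkowski:
  assumes q: "1 \<le> q" and u: "u \<in> Lq_functions q \<Omega>" and v: "v \<in> Lq_functions q \<Omega>"
  shows "(\<lambda>x. u x + v x) \<in> Lq_functions q \<Omega>"
    and "Lq_norm q \<Omega> (\<lambda>x. u x + v x) \<le> Lq_norm q \<Omega> u + Lq_norm q \<Omega> v"
proof -
  let ?M = "lebesgue_on \<Omega>"
  have [measurable]: "u \<in> borel_measurable ?M" "v \<in> borel_measurable ?M"
    and iu: "integrable ?M (\<lambda>x. \<bar>u x\<bar> powr q)" and iv: "integrable ?M (\<lambda>x. \<bar>v x\<bar> powr q)"
    using u v by (auto simp: Lq_functions_def)
  have key: "\<bar>u x + v x\<bar> powr q \<le>
      (a + b) powr q * ((a / (a + b)) * (\<bar>u x\<bar> powr q / a powr q) + (b / (a + b)) * (\<bar>v x\<bar> powr q / b powr q))"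
    if "0 < a" "0 < b" for a b x
  proof -
    have "\<bar>u x + v x\<bar> powr q \<le> (\<bar>u x\<bar> + \<bar>v x\<bar>) powr q"
      using q by (intro powr_mono2) auto
    also have "\<bar>u x\<bar> + \<bar>v x\<bar> = (a + b) * ((a / (a + b)) * (\<bar>u x\<bar> / a) + (b / (a + b)) * (\<bar>v x\<bar> / b))"
      using that by (simp add: distrib_left)
    also have "\<dots> powr q = (a + b) powr q * ((a / (a + b)) * (\<bar>u x\<bar> / a) + (b / (a + b)) * (\<bar>v x\<bar> / b)) powr q"
      by (rule powr_mult)
    also have "\<dots> \<le> (a + b) powr q * ((a / (a + b)) * (\<bar>u x\<bar> / a) powr q + (b / (a + b)) * (\<bar>v x\<bar> / b) powr q)"
      using that q by (intro mult_left_mono powr_convex_nonneg) (auto simp: add_divide_distrib[symmetric])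
    finally show ?thesis using that by (simp add: powr_divide)
  qed
  have int: "integrable ?M (\<lambda>x. \<bar>u x + v x\<bar> powr q)"
    by (rule Bochner_Integration.integrable_bound
        [where f = "\<lambda>x. (1 + 1) powr q * ((1 / (1 + 1)) * (\<bar>u x\<bar> powr q / 1 powr q) + (1 / (1 + 1)) * (\<bar>v x\<bar> powr q / 1 powr q))"])
      (use iu iv key[of 1 1] in auto)
  then show "(\<lambda>x. u x + v x) \<in> Lq_functions q \<Omega>" by (simp add: Lq_functions_def)
  define a where "a = Lq_norm q \<Omega> u"
  define b where "b = Lq_norm q \<Omega> v"
  have "0 \<le> a" "0 \<le> b" by (simp_all add: a_def b_def Lq_norm_nonneg)
  then consider "a = 0" | "b = 0" | "0 < a" "0 < b" by linarith
  then show "Lq_norm q \<Omega> (\<lambda>x. u x + v x) \<le> Lq_norm q \<Omega> u + Lq_norm q \<Omega> v"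
  proof cases
    case 1
    then have "AE x in ?M. u x = 0" using Lq_norm_eq_0_iff[OF u] by (simp add: a_def)
    then have "Lq_norm q \<Omega> (\<lambda>x. u x + v x) = Lq_norm q \<Omega> v"
      by (intro Lq_norm_cong_AE) auto
    then show ?thesis by (simp add: Lq_norm_nonneg)
  next
    case 2
    then have "AE x in ?M. v x = 0" using Lq_norm_eq_0_iff[OF v] by (simp add: b_def)
    then have "Lq_norm q \<Omega> (\<lambda>x. u x + v x) = Lq_norm q \<Omega> u"
      by (intro Lq_norm_cong_AE) auto
    then show ?thesis by (simp add: Lq_norm_nonneg)
  next
    case 3
    have "Lq_norm q \<Omega> (\<lambda>x. u x + v x) powr q = (LINT x|?M. \<bar>u x + v x\<bar> powr q)"
      using q by (simp add: Lq_functions_norm_powr)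
    also have "\<dots> \<le> (LINT x|?M. (a + b) powr q * ((a / (a + b)) * (\<bar>u x\<bar> powr q / a powr q) +
        (b / (a + b)) * (\<bar>v x\<bar> powr q / b powr q)))"
      using int iu iv key[OF 3] by (intro integral_mono) auto
    also have "\<dots> = (a + b) powr q * ((a / (a + b)) * ((LINT x|?M. \<bar>u x\<bar> powr q) / a powr q) +
        (b / (a + b)) * ((LINT x|?M. \<bar>v x\<bar> powr q) / b powr q))"
      using iu iv by simp
    also have "\<dots> = (a + b) powr q * (a / (a + b) + b / (a + b))"
      using q 3 by (simp add: Lq_functions_norm_powr a_def[symmetric] b_def[symmetric])
    also have "\<dots> = (a + b) powr q" using 3 by (simp add: add_divide_distrib[symmetric])
    finally have "Lq_norm q \<Omega> (\<lambda>x. u x + v x) powr q \<le> (a + b) powr q" .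
    then have "Lq_norm q \<Omega> (\<lambda>x. u x + v x) \<le> a + b"
      using powr_less_mono2[of q "a + b" "Lq_norm q \<Omega> (\<lambda>x. u x + v x)"] q 3 by force
    then show ?thesis by (simp add: a_def b_def)
  qed
qed

lemma Lq_functions_minus:
  assumes "u \<in> Lq_functions q \<Omega>"
  shows "(\<lambda>x. - u x) \<in> Lq_functions q \<Omega>"
  using assms by (auto simp: Lq_functions_def)

lemma Lq_functions_diff:
  assumes "1 \<le> q" "u \<in> Lq_functions q \<Omega>" "v \<in> Lq_functions q \<Omega>"
  shows "(\<lambda>x. u x - v x) \<in> Lq_functions q \<Omega>"
  using Lq_minkowski(1)[OF assms(1,2) Lq_functions_minus[OF assms(3)]] by simp

lemma Lq_rep: "U \<in> Lq q \<Omega> \<Longrightarrow> rep U \<in> Lq_functions q \<Omega>"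
  using Lq_member rep_in Lq_subset_L0 by blast

lemma Lq_dist_eq:
  assumes "U \<in> Lq q \<Omega>" "V \<in> Lq q \<Omega>" "u \<in> U" "v \<in> V"
  shows "Lq_dist q \<Omega> U V = Lq_norm q \<Omega> (\<lambda>x. u x - v x)"
proof -
  have UV: "U \<in> L0 \<Omega>" "V \<in> L0 \<Omega>" using assms Lq_subset_L0 by auto
  have "(rep U, u) \<in> ae_eq \<Omega>" "(rep V, v) \<in> ae_eq \<Omega>"
    using L0_ae_eq[OF UV(1) rep_in[OF UV(1)] assms(3)]
      L0_ae_eq[OF UV(2) rep_in[OF UV(2)] assms(4)] by auto
  then show ?thesis
    unfolding Lq_dist_def ae_eq_def by (intro Lq_norm_cong_AE) auto
qed

theorem Metric_space_Lq:
  assumes q: "1 \<le> q"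
  shows "Metric_space (Lq q \<Omega>) (Lq_dist q \<Omega>)"
proof
  fix U V :: "('a \<Rightarrow> real) set"
  show "0 \<le> Lq_dist q \<Omega> U V" by (simp add: Lq_dist_def Lq_norm_nonneg)
  show "Lq_dist q \<Omega> U V = Lq_dist q \<Omega> V U"
    by (simp add: Lq_dist_def Lq_norm_def abs_minus_commute)
next
  fix U V :: "('a \<Rightarrow> real) set"
  assume UV: "U \<in> Lq q \<Omega>" "V \<in> Lq q \<Omega>"
  then have L0: "U \<in> L0 \<Omega>" "V \<in> L0 \<Omega>" using Lq_subset_L0 by auto
  have meas: "rep U \<in> borel_measurable (lebesgue_on \<Omega>)" "rep V \<in> borel_measurable (lebesgue_on \<Omega>)"
    using L0 L0_measurable rep_in by blast+
  have "Lq_dist q \<Omega> U V = 0 \<longleftrightarrow> (AE x in lebesgue_on \<Omega>. rep U x - rep V x = 0)"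
    unfolding Lq_dist_def
    by (rule Lq_norm_eq_0_iff) (use Lq_functions_diff[OF q] Lq_rep UV in blast)
  also have "\<dots> \<longleftrightarrow> (rep U, rep V) \<in> ae_eq \<Omega>" using meas by (simp add: ae_eq_def)
  also have "\<dots> \<longleftrightarrow> U = V"
    using L0 rep_in[OF L0(1)] rep_in[OF L0(2)] quotient_eq_iff[OF equiv_ae_eq]
    unfolding L0_def by metis
  finally show "Lq_dist q \<Omega> U V = 0 \<longleftrightarrow> U = V" .
next
  fix U V W :: "('a \<Rightarrow> real) set"
  assume "U \<in> Lq q \<Omega>" "V \<in> Lq q \<Omega>" "W \<in> Lq q \<Omega>"
  then have "rep U \<in> Lq_functions q \<Omega>" "rep V \<in> Lq_functions q \<Omega>" "rep W \<in> Lq_functions q \<Omega>"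
    using Lq_rep by blast+
  from Lq_minkowski(2)[OF q Lq_functions_diff[OF q this(1,2)] Lq_functions_diff[OF q this(2,3)]]
  show "Lq_dist q \<Omega> U W \<le> Lq_dist q \<Omega> U V + Lq_dist q \<Omega> V W"
    by (simp add: Lq_dist_def)
qed

lemma mspace_Lq_metric: "1 \<le> q \<Longrightarrow> mspace (Lq_metric q \<Omega>) = Lq q \<Omega>"
  and mdist_Lq_metric: "1 \<le> q \<Longrightarrow> mdist (Lq_metric q \<Omega>) = Lq_dist q \<Omega>"
  by (simp_all add: Lq_metric_def Metric_space.mspace_metric Metric_space.mdist_metric Metric_space_Lq)

lemma cont_reps_unique:
  assumes "open \<Omega>" "U \<in> L0 \<Omega>" "v \<in> cont_reps \<Omega> U" "w \<in> cont_reps \<Omega> U" "x \<in> closure \<Omega>"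
  shows "v x = w x"
proof -
  have cont: "continuous_on (closure \<Omega>) (\<lambda>x. v x - w x)"
    using assms by (auto simp: cont_reps_def intro: continuous_on_diff)
  have "(v, w) \<in> ae_eq \<Omega>" using assms L0_ae_eq by (auto simp: cont_reps_def)
  then have ae: "AE x in lebesgue_on \<Omega>. v x - w x = 0" by (auto simp: ae_eq_def)
  let ?A = "{x \<in> \<Omega>. v x - w x \<noteq> 0}"
  have "open ?A"
  proof -
    have "open (\<Omega> \<inter> (\<lambda>x. v x - w x) -` (- {0}))"
      using continuous_on_subset[OF cont closure_subset] assms(1)
      by (intro continuous_open_preimage) auto
    moreover have "\<Omega> \<inter> (\<lambda>x. v x - w x) -` (- {0}) = ?A" by auto
    ultimately show ?thesis by simp
  qed
  moreover have "negligible ?A"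
  proof -
    have "AE x in lebesgue. x \<in> \<Omega> \<longrightarrow> v x - w x = 0"
      using ae assms(1) by (subst (asm) AE_restrict_space_iff) auto
    then have "?A \<in> null_sets lebesgue"
      by (subst AE_iff_null_sets) (use \<open>open ?A\<close> in \<open>auto elim!: eventually_mono\<close>)
    then show ?thesis by (simp add: negligible_iff_null_sets)
  qed
  ultimately have "?A = {}" using open_not_negligible by blast
  then have "(\<lambda>x. v x - w x) y = 0" if "y \<in> \<Omega>" for y using that by auto
  from continuous_constant_on_closure[OF cont this assms(5)] show ?thesis by simp
qed

lemma frac_seminorm_cong_AE:
  assumes "\<Omega> \<in> sets lebesgue" "(u, v) \<in> ae_eq \<Omega>"
  shows "frac_seminorm \<alpha> p \<Omega> u = frac_seminorm \<alpha> p \<Omega> v"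
proof -
  let ?M = "lebesgue_on \<Omega>"
  have "sigma_finite_measure (lebesgue :: 'a measure)"
  proof
    from lborel.sigma_finite_countable obtain A :: "'a set set"
      where "countable A" "A \<subseteq> sets lborel" "\<Union>A = space lborel" "\<forall>a\<in>A. emeasure lborel a \<noteq> \<infinity>"
      by blast
    then show "\<exists>A::'a set set. countable A \<and> A \<subseteq> sets lebesgue \<and> \<Union>A = space lebesgue \<and>
        (\<forall>a\<in>A. emeasure lebesgue a \<noteq> \<infinity>)"
      by (intro exI[of _ A]) auto
  qed
  then have "sigma_finite_measure ?M"
    by (rule sigma_finite_measure_restrict_space) (use assms in auto)
  note Times = sigma_finite_measure.emeasure_pair_measure_Times[OF this]
  obtain N where N: "N \<in> null_sets ?M" "{x \<in> space ?M. u x \<noteq> v x} \<subseteq> N"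
    using assms(2) by (auto simp: ae_eq_def eventually_ae_filter)
  have "N \<times> space ?M \<in> null_sets (?M \<Otimes>\<^sub>M ?M)" "space ?M \<times> N \<in> null_sets (?M \<Otimes>\<^sub>M ?M)"
    using N(1) Times[of N ?M "space ?M"] Times[of "space ?M" ?M N]
    by (auto simp: null_sets_def simp del: space_restrict_space)
  then have "N \<times> space ?M \<union> space ?M \<times> N \<in> null_sets (?M \<Otimes>\<^sub>M ?M)" by blast
  then have "AE z in ?M \<Otimes>\<^sub>M ?M. z \<notin> N \<times> space ?M \<union> space ?M \<times> N" by (rule AE_not_in)
  then have ae: "AE z in ?M \<Otimes>\<^sub>M ?M. u (fst z) = v (fst z) \<and> u (snd z) = v (snd z)"
    by (rule AE_mp, intro AE_I2) (use N(2) in \<open>auto simp: space_pair_measure\<close>)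
  have "AE z in ?M \<Otimes>\<^sub>M ?M.
      (case z of (x, y) \<Rightarrow> ennreal (\<bar>u x - u y\<bar> powr p / norm (x - y) powr (\<alpha> * p))) =
      (case z of (x, y) \<Rightarrow> ennreal (\<bar>v x - v y\<bar> powr p / norm (x - y) powr (\<alpha> * p)))"
    by (rule eventually_mono[OF ae]) auto
  from nn_integral_cong_AE[OF this] show ?thesis
    by (simp only: frac_seminorm_def)
qed

end

theory Submission
  imports Defs
begin

text \<open>For the lower bound, normalise: \<open>E_p (u_p) \<le> L\<close> says that the double integral of
  \<open>(H_p / L)\<close> to the power \<open>p\<close> is at most \<open>1\<close>, where \<open>H_p\<close> is the Hoelder quotient of \<open>u_p\<close>. Along
  a subsequence converging almost everywhere, Fatou's lemma makes the lower limit of these powers finite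
  almost everywhere, which forces the limiting quotient below \<open>L\<close>; McShane's extension then gives a
  continuous representative. Boundary values survive the limit because a Lipschitz domain contains a
  sequence of balls shrinking to each boundary point along an interior cone, and the averages over these
  balls converge to the boundary value at a geometric rate controlled by the energy for one fixed
  exponent, uniformly along the sequence. Constant sequences serve as recovery sequences, and McShane's
  extension of \<open>\<phi>\<close> gives a competitor of finite energy.\<close>

section \<open>Hoelder functions and elementary inequalities\<close>

text \<open>The obstacle is the boundary condition: convergence in \<open>Lq\<close> says nothing on
  a null set, and an estimate whose constant depends on p need not survive p tending to infinity. So
  the energy bound is first transferred to a single exponent r, with a constant independent of p.
  The threshold 2N/\<alpha> enters through this r: comparing averages over two balls of radius of
  order t divides a double integral by both volumes and costs t^(-2N), while the weight gains
  t^(\<alpha> r). Only boundary points need such an estimate, and it may lose constants. The Hoelder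
  bound must not, since the limit functional has to come out exactly. The energy compares all pairs
  of points of the domain, not only nearby ones, so Fatou's lemma gives the sharp constant for
  almost all pairs, whatever the shape of the domain. In place of Hoelder's integral inequality,
  elementary pointwise bounds split an integrand at a threshold that is chosen afterwards to balance
  the terms.\<close>

lemma powr_add_le_add_powr:
  fixes a b s :: real
  assumes "0 \<le> a" "0 \<le> b" "0 < s" "s \<le> 1"
  shows "(a + b) powr s \<le> a powr s + b powr s"
proof (cases "a + b = 0")
  case False
  then have pos: "0 < a + b" using assms by simp
  have le: "c \<le> c powr s" if "0 \<le> c" "c \<le> 1" for c :: real
    using powr_mono'[of s 1 c] that assms by simp
  have "1 = a / (a + b) + b / (a + b)" using pos by (simp add: add_divide_distrib[symmetric])
  also have "\<dots> \<le> (a / (a + b)) powr s + (b / (a + b)) powr s"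
    using assms pos by (intro add_mono le) auto
  also have "\<dots> = (a powr s + b powr s) / (a + b) powr s"
    using assms pos by (simp add: powr_divide add_divide_distrib)
  finally show ?thesis using pos by (simp add: field_simps)
qed (use assms in auto)

text \<open>The real-valued counterpart of a bound on \<open>holder_seminorm\<close>, with the
  denominator multiplied out: on the diagonal both sides are 0, so no case distinction arises there,
  and any admissible constant can be used without computing a supremum.\<close>

definition holder_on :: "real \<Rightarrow> real \<Rightarrow> 'a::real_normed_vector set \<Rightarrow> ('a \<Rightarrow> real) \<Rightarrow> bool" where
  "holder_on \<alpha> L S f \<longleftrightarrow> (\<forall>x\<in>S. \<forall>y\<in>S. \<bar>f x - f y\<bar> \<le> L * norm (x - y) powr \<alpha>)"

lemma holder_onD: "holder_on \<alpha> L S f \<Longrightarrow> x \<in> S \<Longrightarrow> y \<in> S \<Longrightarrow> \<bar>f x - f y\<bar> \<le> L * norm (x - y) powr \<alpha>"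
  by (simp add: holder_on_def)

lemma holder_on_subset: "holder_on \<alpha> L T f \<Longrightarrow> S \<subseteq> T \<Longrightarrow> holder_on \<alpha> L S f"
  by (auto simp: holder_on_def)

lemma norm_diff_powr_triangle:
  fixes x y z :: "'a::real_normed_vector"
  assumes "0 < s" "s \<le> 1"
  shows "norm (x - z) powr s \<le> norm (x - y) powr s + norm (y - z) powr s"
proof -
  have "norm (x - z) powr s \<le> (norm (x - y) + norm (y - z)) powr s"
    using assms norm_triangle_ineq[of "x - y" "y - z"] by (intro powr_mono2) auto
  also have "\<dots> \<le> norm (x - y) powr s + norm (y - z) powr s"
    using assms by (intro powr_add_le_add_powr) auto
  finally show ?thesis .
qed

lemma holder_on_continuous:
  assumes "holder_on \<alpha> L S f" "0 < \<alpha>"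
  shows "continuous_on S f"
  unfolding continuous_on_def
proof
  fix x assume x: "x \<in> S"
  have "((\<lambda>y. L * norm (y - x) powr \<alpha>) \<longlongrightarrow> L * norm (x - x) powr \<alpha>) (at x within S)"
    using assms(2) by (intro tendsto_intros) auto
  then have "((\<lambda>y. L * norm (y - x) powr \<alpha>) \<longlongrightarrow> 0) (at x within S)" using assms(2) by simp
  moreover have "\<forall>\<^sub>F y in at x within S. norm (f y - f x) \<le> L * norm (y - x) powr \<alpha>"
    using holder_onD[OF assms(1) _ x] by (auto simp: eventually_at_filter)
  ultimately have "((\<lambda>y. f y - f x) \<longlongrightarrow> 0) (at x within S)"
    by (rule Lim_null_comparison[rotated])
  then show "(f \<longlongrightarrow> f x) (at x within S)" by (simp add: LIM_zero_iff)
qed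

text \<open>McShane: \<open>norm (x - y) powr \<alpha>\<close> is itself a metric.\<close>

lemma holder_on_extension:
  fixes f :: "'a::real_normed_vector \<Rightarrow> real"
  assumes f: "holder_on \<alpha> L S f" and L: "0 \<le> L" and \<alpha>: "0 < \<alpha>" "\<alpha> \<le> 1"
  obtains g where "holder_on \<alpha> L UNIV g" "\<And>x. x \<in> S \<Longrightarrow> g x = f x"
proof (cases "S = {}")
  case True
  show ?thesis by (rule that[of "\<lambda>_. 0"]) (use True L in \<open>auto simp: holder_on_def\<close>)
next
  case False
  then obtain s where s: "s \<in> S" by blast
  define d where "d x y = L * norm (x - y) powr \<alpha>" for x y :: 'a
  have tri: "d x z \<le> d x y + d y z" for x y z
    unfolding d_def distrib_left[symmetric]
    by (intro mult_left_mono norm_diff_powr_triangle \<alpha> L)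
  have comm: "d x y = d y x" for x y by (simp add: d_def norm_minus_commute)
  have fd: "f x - f y \<le> d x y" if "x \<in> S" "y \<in> S" for x y
    using holder_onD[OF f that] by (simp add: d_def)
  \<comment> \<open>The inf-convolution of \<open>f\<close> with \<open>d\<close>, which is the
    largest extension of \<open>f\<close> that is 1-Lipschitz for \<open>d\<close>. The fixed point
    \<open>s\<close> bounds the infimum from below.\<close>
  define g where "g x = (INF y\<in>S. f y + d x y)" for x
  have bdd: "bdd_below ((\<lambda>y. f y + d x y) ` S)" for x
  proof (rule bdd_belowI2)
    fix y assume "y \<in> S"
    then show "f s - d s x \<le> f y + d x y" using fd[OF s, of y] tri[of s y x] by simp
  qed
  have le: "g x \<le> f y + d x y" if "y \<in> S" for x y
    unfolding g_def by (rule cINF_lower[OF bdd that])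
  have gd: "g x - d x z \<le> g z" for x z
    unfolding g_def[of z]
  proof (rule cINF_greatest[OF False])
    fix y assume "y \<in> S"
    then show "g x - d x z \<le> f y + d z y" using le[of y x] tri[of x y z] by simp
  qed
  have "holder_on \<alpha> L UNIV g"
    unfolding holder_on_def d_def[symmetric]
  proof (intro ballI)
    fix x z show "\<bar>g x - g z\<bar> \<le> d x z" using gd[of x z] gd[of z x] comm[of x z] by simp
  qed
  moreover have "g x = f x" if "x \<in> S" for x
  proof (rule antisym)
    show "g x \<le> f x" using le[OF that, of x] \<alpha> by (simp add: d_def)
    show "f x \<le> g x" unfolding g_def
      by (rule cINF_greatest[OF False]) (use fd[OF that] in fastforce)
  qed
  ultimately show ?thesis by (rule that)
qed

section \<open>Extended-valued seminorms and roots against real constants\<close>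

lemma holder_seminorm_le_iff:
  assumes "0 \<le> L"
  shows "holder_seminorm \<alpha> S f \<le> ennreal L \<longleftrightarrow> holder_on \<alpha> L S f"
proof -
  have "holder_seminorm \<alpha> S f \<le> ennreal L \<longleftrightarrow>
      (\<forall>x\<in>S. \<forall>y\<in>S. x \<noteq> y \<longrightarrow> \<bar>f x - f y\<bar> / norm (x - y) powr \<alpha> \<le> L)"
    using assms by (auto simp: holder_seminorm_def SUP_le_iff)
  also have "\<dots> \<longleftrightarrow> holder_on \<alpha> L S f"
    unfolding holder_on_def
    by (intro ball_cong refl) (auto simp: divide_le_eq)
  finally show ?thesis .
qed

lemma holder_seminorm_finiteE:
  assumes "holder_seminorm \<alpha> S f < \<infinity>"
  obtains L where "0 \<le> L" "holder_seminorm \<alpha> S f = ennreal L" "holder_on \<alpha> L S f"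
proof (cases "holder_seminorm \<alpha> S f" rule: ennreal_cases)
  case (real L)
  then show ?thesis using that[of L] holder_seminorm_le_iff[of L \<alpha> S f] by simp
qed (use assms in simp)

lemma holder_seminorm_cong:
  "(\<And>x. x \<in> S \<Longrightarrow> f x = g x) \<Longrightarrow> holder_seminorm \<alpha> S f = holder_seminorm \<alpha> S g"
  unfolding holder_seminorm_def by (intro SUP_cong) auto

lemma ennreal_root_le:
  assumes "I \<le> ennreal (B powr p)" "0 \<le> B" "0 < p"
  shows "ennreal_root p I \<le> ennreal B"
proof -
  obtain i where i: "I = ennreal i" "0 \<le> i" "i \<le> B powr p"
    using assms(1) by (cases I rule: ennreal_cases) (auto simp: top_unique)
  have "i powr (1 / p) \<le> (B powr p) powr (1 / p)" using i assms by (intro powr_mono2) auto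
  then show ?thesis using i assms by (auto simp: ennreal_root_def powr_powr)
qed

lemma ennreal_root_leD:
  assumes "ennreal_root p I \<le> ennreal B" "0 \<le> B" "0 < p"
  shows "I \<le> ennreal (B powr p)"
proof -
  obtain i where i: "I = ennreal i" "0 \<le> i"
    using assms(1) by (cases I rule: ennreal_cases) (auto simp: ennreal_root_def top_unique)
  then have "i powr (1 / p) \<le> B" using assms by (simp add: ennreal_root_def)
  then have "(i powr (1 / p)) powr p \<le> B powr p" using assms by (intro powr_mono2) auto
  then show ?thesis using i assms by (auto simp: powr_powr intro!: ennreal_leI)
qed

text \<open>For t > e the factor (t/e)^(r-1) is at least 1. This replaces Hoelder's inequality: it
  bounds a first-power integral by an r-th power one, and the threshold \<open>e\<close> stays
  free.\<close>

lemma le_eps_plus_powr: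
  fixes t e r :: real
  assumes "0 \<le> t" "0 < e" "1 \<le> r"
  shows "t \<le> e + e powr (1 - r) * t powr r"
proof (cases "t \<le> e")
  case False
  then have t: "0 < t" "e \<le> t" using assms by auto
  have "1 = e powr (1 - r) * e powr (r - 1)"
    using assms by (simp add: powr_add[symmetric])
  also have "\<dots> \<le> e powr (1 - r) * t powr (r - 1)"
    using assms t by (intro mult_left_mono powr_mono2) auto
  finally have "t * 1 \<le> t * (e powr (1 - r) * t powr (r - 1))"
    using t by (intro mult_left_mono) auto
  also have "\<dots> = e powr (1 - r) * t powr r" using t by (simp add: powr_diff)
  finally show ?thesis using assms by simp
qed (use assms in \<open>simp add: add_increasing2\<close>)

lemma geometric_telescope_bound:
  fixes a :: "nat \<Rightarrow> real"
  assumes step: "\<And>k. \<bar>a k - a (Suc k)\<bar> \<le> D * \<theta> ^ k" and \<theta>: "0 \<le> \<theta>" "\<theta> < 1" and "0 \<le> D"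
    and lim: "a \<longlonglongrightarrow> l"
  shows "\<bar>a k - l\<bar> \<le> D / (1 - \<theta>) * \<theta> ^ k"
proof -
  \<comment> \<open>The partial geometric sum is kept exactly: without the subtracted
    \<open>\<theta> ^ (k + j)\<close> the bound would not reproduce itself in the induction
    step.\<close>
  have *: "\<bar>a k - a (k + j)\<bar> \<le> D / (1 - \<theta>) * (\<theta> ^ k - \<theta> ^ (k + j))" for j
  proof (induction j)
    case (Suc j)
    have "\<bar>a k - a (k + Suc j)\<bar> \<le> \<bar>a k - a (k + j)\<bar> + \<bar>a (k + j) - a (Suc (k + j))\<bar>" by simp
    also have "\<dots> \<le> D / (1 - \<theta>) * (\<theta> ^ k - \<theta> ^ (k + j)) + D * \<theta> ^ (k + j)"
      using Suc step by (intro add_mono) auto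
    also have "\<dots> = D / (1 - \<theta>) * (\<theta> ^ k - \<theta> ^ (k + Suc j))"
      using \<theta> by (simp add: field_simps)
    finally show ?case .
  qed simp
  have "\<bar>a k - a (k + j)\<bar> \<le> D / (1 - \<theta>) * \<theta> ^ k" for j
    using *[of j] \<theta> \<open>0 \<le> D\<close> by (smt (verit) divide_nonneg_pos mult_left_mono zero_le_power)
  moreover have "(\<lambda>j. \<bar>a k - a (k + j)\<bar>) \<longlonglongrightarrow> \<bar>a k - l\<bar>"
    using LIMSEQ_ignore_initial_segment[OF lim, of k]
    by (intro tendsto_intros) (simp add: add.commute)
  ultimately show ?thesis by (intro LIMSEQ_le_const2) auto
qed

section \<open>Averages and fractional energies\<close>

definition average :: "'a measure \<Rightarrow> 'a set \<Rightarrow> ('a \<Rightarrow> real) \<Rightarrow> real" where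
  "average M A f = (LINT x|M. indicator A x * f x) / measure M A"

text \<open>The left side is the modulus of the integral of \<open>f - c\<close> over
  \<open>A\<close>. The division is cleared and the bound is stated in \<open>ennreal\<close> so
  that it can be used again under an integral sign.\<close>

lemma average_diff_const_le:
  assumes "finite_measure M" "A \<in> sets M" "0 < measure M A" "integrable M f"
  shows "ennreal (\<bar>average M A f - c\<bar> * measure M A) \<le> (\<integral>\<^sup>+x. ennreal (indicator A x * \<bar>f x - c\<bar>) \<partial>M)"
proof -
  interpret finite_measure M by fact
  have iA: "integrable M (\<lambda>x. indicator A x * f x)" "integrable M (\<lambda>x. indicator A x * c)"
    using integrable_real_mult_indicator[OF assms(2,4)] integrable_real_mult_indicator[OF assms(2), of "\<lambda>_. c"]
    by (simp_all add: mult.commute[of "indicator A _"])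
  have "(average M A f - c) * measure M A = (LINT x|M. indicator A x * f x) - (LINT x|M. indicator A x * c)"
    using assms by (simp add: average_def field_simps)
  also have "\<dots> = (LINT x|M. indicator A x * (f x - c))"
    by (simp add: Bochner_Integration.integral_diff[OF iA, symmetric] right_diff_distrib del: integral_mult_left integral_mult_left_zero)
  finally have "\<bar>average M A f - c\<bar> * measure M A = norm (LINT x|M. indicator A x * (f x - c))"
    using assms by (metis abs_mult abs_of_pos real_norm_def)
  moreover have "integrable M (\<lambda>x. indicator A x * (f x - c))"
    using Bochner_Integration.integrable_diff[OF iA] by (simp add: right_diff_distrib)
  ultimately show ?thesis
    using integral_norm_bound_ennreal[of M "\<lambda>x. indicator A x * (f x - c)"] by (simp add: abs_mult)
qed

text \<open>Two uses of the constant case: over \<open>A\<close> with the constant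
  \<open>average M B f\<close>, then, for each fixed \<open>x\<close>, over \<open>B\<close> with
  the constant \<open>f x\<close>.\<close>

lemma average_diff_le:
  assumes "finite_measure M" "A \<in> sets M" "B \<in> sets M" "0 < measure M A" "0 < measure M B"
    and f: "integrable M f"
  shows "ennreal (\<bar>average M A f - average M B f\<bar> * measure M A * measure M B) \<le>
    (\<integral>\<^sup>+x. (\<integral>\<^sup>+y. ennreal (indicator A x * indicator B y * \<bar>f x - f y\<bar>) \<partial>M) \<partial>M)"
proof -
  interpret finite_measure M by fact
  have [measurable]: "f \<in> borel_measurable M" "A \<in> sets M" "B \<in> sets M" using assms by auto
  let ?b = "average M B f"
  have "ennreal (\<bar>average M A f - ?b\<bar> * measure M A * measure M B) =
      ennreal (\<bar>average M A f - ?b\<bar> * measure M A) * ennreal (measure M B)"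
    by (simp add: ennreal_mult)
  also have "\<dots> \<le> (\<integral>\<^sup>+x. ennreal (indicator A x * \<bar>f x - ?b\<bar>) \<partial>M) * ennreal (measure M B)"
    by (intro mult_right_mono average_diff_const_le assms) auto
  also have "\<dots> = (\<integral>\<^sup>+x. ennreal (indicator A x * \<bar>f x - ?b\<bar>) * ennreal (measure M B) \<partial>M)"
    by (rule nn_integral_multc[symmetric]) measurable
  also have "\<dots> \<le> (\<integral>\<^sup>+x. (\<integral>\<^sup>+y. ennreal (indicator A x * indicator B y * \<bar>f x - f y\<bar>) \<partial>M) \<partial>M)"
  proof (rule nn_integral_mono)
    fix x
    have "ennreal (indicator A x * \<bar>f x - ?b\<bar>) * ennreal (measure M B) =
        ennreal (indicator A x) * ennreal (\<bar>?b - f x\<bar> * measure M B)"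
      by (simp add: ennreal_mult abs_minus_commute mult.assoc)
    also have "\<dots> \<le> ennreal (indicator A x) * (\<integral>\<^sup>+y. ennreal (indicator B y * \<bar>f y - f x\<bar>) \<partial>M)"
      by (intro mult_left_mono average_diff_const_le assms) auto
    also have "\<dots> = (\<integral>\<^sup>+y. ennreal (indicator A x * indicator B y * \<bar>f x - f y\<bar>) \<partial>M)"
      by (subst nn_integral_cmult[symmetric])
        (auto intro!: nn_integral_cong simp: ennreal_mult abs_minus_commute mult.assoc)
    finally show "ennreal (indicator A x * \<bar>f x - ?b\<bar>) * ennreal (measure M B) \<le>
      (\<integral>\<^sup>+y. ennreal (indicator A x * indicator B y * \<bar>f x - f y\<bar>) \<partial>M)" .
  qed
  finally show ?thesis .
qed

section \<open>Integrability and fractional energies on bounded open sets\<close>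

lemma finite_measure_lebesgue_on_open:
  "open \<Omega> \<Longrightarrow> bounded \<Omega> \<Longrightarrow> finite_measure (lebesgue_on (\<Omega> :: 'a::euclidean_space set))"
  by (intro finite_measure_lebesgue_on lmeasurable_open)

lemma borel_measurable_id_lebesgue_on: "(\<lambda>x. x) \<in> borel_measurable (lebesgue_on \<Omega>)"
  by (intro measurable_restrict_space1 measurable_completion) simp

lemma integrable_continuous_closure:
  fixes f :: "'a::euclidean_space \<Rightarrow> real"
  assumes "open \<Omega>" "bounded \<Omega>" "continuous_on (closure \<Omega>) f"
  shows "integrable (lebesgue_on \<Omega>) f"
proof -
  interpret finite_measure "lebesgue_on \<Omega>" using assms by (intro finite_measure_lebesgue_on_open)
  have "compact (f ` closure \<Omega>)" using assms by (intro compact_continuous_image) auto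
  then obtain B where "\<And>x. x \<in> closure \<Omega> \<Longrightarrow> norm (f x) \<le> B"
    using compact_imp_bounded bounded_iff by (metis image_eqI)
  moreover have "f \<in> borel_measurable (lebesgue_on \<Omega>)"
    using assms by (intro continuous_imp_measurable_on_sets_lebesgue)
      (auto intro: continuous_on_subset[OF _ closure_subset])
  ultimately show ?thesis
    by (intro integrable_const_bound[of _ B] AE_I2) (use closure_subset[of \<Omega>] in auto)
qed

definition holder_quotient :: "real \<Rightarrow> ('a::real_normed_vector \<Rightarrow> real) \<Rightarrow> 'a \<Rightarrow> 'a \<Rightarrow> real" where
  "holder_quotient \<alpha> u x y = \<bar>u x - u y\<bar> / norm (x - y) powr \<alpha>"

text \<open>The energy before the root is taken, as an iterated integral because the estimates for
  averages freeze one variable. The product form, needed for Fatou's lemma, is recovered in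
  \<open>frac_energy_eq_pair\<close>.\<close>

definition frac_energy :: "real \<Rightarrow> real \<Rightarrow> 'a::euclidean_space set \<Rightarrow> ('a \<Rightarrow> real) \<Rightarrow> ennreal" where
  "frac_energy \<alpha> p \<Omega> u =
     (\<integral>\<^sup>+x. (\<integral>\<^sup>+y. ennreal (holder_quotient \<alpha> u x y powr p) \<partial>lebesgue_on \<Omega>) \<partial>lebesgue_on \<Omega>)"

lemma holder_quotient_nonneg: "0 \<le> holder_quotient \<alpha> u x y"
  by (simp add: holder_quotient_def)

lemma holder_quotient_le_iff:
  assumes "0 \<le> L"
  shows "holder_quotient \<alpha> u x y \<le> L \<longleftrightarrow> \<bar>u x - u y\<bar> \<le> L * norm (x - y) powr \<alpha>"
  using assms by (cases "x = y") (auto simp: holder_quotient_def divide_le_eq)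

lemma holder_quotient_measurable [measurable]:
  fixes u :: "'a::euclidean_space \<Rightarrow> real"
  assumes [measurable]: "u \<in> borel_measurable (lebesgue_on \<Omega>)"
  shows "(\<lambda>(x, y). holder_quotient \<alpha> u x y) \<in> borel_measurable (lebesgue_on \<Omega> \<Otimes>\<^sub>M lebesgue_on \<Omega>)"
  using borel_measurable_id_lebesgue_on[of \<Omega>, measurable] unfolding holder_quotient_def by measurable

lemma frac_energy_eq_pair:
  fixes u :: "'a::euclidean_space \<Rightarrow> real"
  assumes "open \<Omega>" "bounded \<Omega>" and [measurable]: "u \<in> borel_measurable (lebesgue_on \<Omega>)"
  shows "(\<integral>\<^sup>+z. ennreal ((case z of (x, y) \<Rightarrow> holder_quotient \<alpha> u x y) powr p)
    \<partial>(lebesgue_on \<Omega> \<Otimes>\<^sub>M lebesgue_on \<Omega>)) = frac_energy \<alpha> p \<Omega> u"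
proof -
  interpret finite_measure "lebesgue_on \<Omega>" using assms by (intro finite_measure_lebesgue_on_open)
  show ?thesis unfolding frac_energy_def by (subst nn_integral_fst[symmetric]) auto
qed

lemma frac_seminorm_eq_energy:
  fixes u :: "'a::euclidean_space \<Rightarrow> real"
  assumes "open \<Omega>" "bounded \<Omega>" and [measurable]: "u \<in> borel_measurable (lebesgue_on \<Omega>)"
  shows "frac_seminorm \<alpha> p \<Omega> u = ennreal_root p (frac_energy \<alpha> p \<Omega> u)"
proof -
  have "(\<integral>\<^sup>+(x, y). ennreal (\<bar>u x - u y\<bar> powr p / norm (x - y) powr (\<alpha> * p)) \<partial>(lebesgue_on \<Omega> \<Otimes>\<^sub>M lebesgue_on \<Omega>))
      = (\<integral>\<^sup>+z. ennreal ((case z of (x, y) \<Rightarrow> holder_quotient \<alpha> u x y) powr p) \<partial>(lebesgue_on \<Omega> \<Otimes>\<^sub>M lebesgue_on \<Omega>))"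
    by (intro nn_integral_cong) (auto simp: holder_quotient_def powr_divide powr_powr)
  also have "\<dots> = frac_energy \<alpha> p \<Omega> u" using assms by (rule frac_energy_eq_pair)
  finally show ?thesis by (simp add: frac_seminorm_def)
qed

lemma frac_energy_holder_le:
  fixes u :: "'a::euclidean_space \<Rightarrow> real"
  assumes \<Omega>: "open \<Omega>" "bounded \<Omega>" and "holder_on \<alpha> L \<Omega> u" "0 \<le> L" "0 < p"
  shows "frac_energy \<alpha> p \<Omega> u \<le> ennreal (L powr p * (measure lebesgue \<Omega>)\<^sup>2)"
proof -
  interpret finite_measure "lebesgue_on \<Omega>" using \<Omega> by (rule finite_measure_lebesgue_on_open)
  have \<mu>: "emeasure (lebesgue_on \<Omega>) \<Omega> = ennreal (measure lebesgue \<Omega>)"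
    using \<Omega> lmeasurable_open[of \<Omega>] by (simp add: emeasure_restrict_space emeasure_eq_measure2)
  have "frac_energy \<alpha> p \<Omega> u \<le> (\<integral>\<^sup>+x. (\<integral>\<^sup>+y. ennreal (L powr p) \<partial>lebesgue_on \<Omega>) \<partial>lebesgue_on \<Omega>)"
    unfolding frac_energy_def
  proof (intro nn_integral_mono ennreal_leI powr_mono2)
    fix x y assume "x \<in> space (lebesgue_on \<Omega>)" "y \<in> space (lebesgue_on \<Omega>)"
    then show "holder_quotient \<alpha> u x y \<le> L"
      using assms by (auto simp: holder_quotient_le_iff holder_on_def)
  qed (use assms holder_quotient_nonneg in auto)
  also have "\<dots> = ennreal (L powr p * (measure lebesgue \<Omega>)\<^sup>2)"
    using \<mu> by (simp add: ennreal_mult power2_eq_square mult.assoc)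
  finally show ?thesis .
qed

text \<open>Pointwise, t^r is at most L^r for t \<le> L, and otherwise t^r = t^(r-p) t^p is at most
  L^(r-p) t^p. After integration the first term yields the squared measure and the second the
  \<open>+ 1\<close>, as L^(r-p) L^p = L^r. The bound is free of p, so one constant serves a whole
  sequence.\<close>

lemma frac_energy_exponent_le:
  fixes u :: "'a::euclidean_space \<Rightarrow> real"
  assumes \<Omega>: "open \<Omega>" "bounded \<Omega>" and [measurable]: "u \<in> borel_measurable (lebesgue_on \<Omega>)"
    and "0 < L" "0 < r" "r \<le> p" and I: "frac_energy \<alpha> p \<Omega> u \<le> ennreal (L powr p)"
  shows "frac_energy \<alpha> r \<Omega> u \<le> ennreal (L powr r * ((measure lebesgue \<Omega>)\<^sup>2 + 1))"
proof -
  interpret finite_measure "lebesgue_on \<Omega>" using \<Omega> by (rule finite_measure_lebesgue_on_open)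
  have \<mu>: "emeasure (lebesgue_on \<Omega>) \<Omega> = ennreal (measure lebesgue \<Omega>)"
    using \<Omega> lmeasurable_open[of \<Omega>] by (simp add: emeasure_restrict_space emeasure_eq_measure2)
  have pw: "t powr r \<le> L powr r + L powr (r - p) * t powr p" if "0 \<le> t" for t
  proof (cases "t \<le> L")
    case True
    then have "t powr r \<le> L powr r" using that assms by (intro powr_mono2) auto
    then show ?thesis by (simp add: add_increasing2)
  next
    case False
    then have "t powr r = t powr (r - p) * t powr p" by (simp add: powr_add[symmetric])
    also have "\<dots> \<le> L powr (r - p) * t powr p"
      using False assms by (intro mult_right_mono powr_mono2') auto
    finally show ?thesis by (simp add: add_increasing)
  qed
  have "frac_energy \<alpha> r \<Omega> u \<le> (\<integral>\<^sup>+x. (\<integral>\<^sup>+y. ennreal (L powr r) + ennreal (L powr (r - p)) *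
      ennreal (holder_quotient \<alpha> u x y powr p) \<partial>lebesgue_on \<Omega>) \<partial>lebesgue_on \<Omega>)"
    unfolding frac_energy_def
    by (intro nn_integral_mono)
      (simp add: ennreal_mult[symmetric] ennreal_plus[symmetric] pw holder_quotient_nonneg del: ennreal_plus)
  also have "\<dots> = ennreal (L powr r * (measure lebesgue \<Omega>)\<^sup>2) +
      ennreal (L powr (r - p)) * frac_energy \<alpha> p \<Omega> u"
  proof -
    define J where "J = (\<lambda>x. \<integral>\<^sup>+y. ennreal (holder_quotient \<alpha> u x y powr p) \<partial>lebesgue_on \<Omega>)"
    have [measurable]: "J \<in> borel_measurable (lebesgue_on \<Omega>)"
      unfolding J_def by (rule borel_measurable_nn_integral) measurable
    have "(\<integral>\<^sup>+x. (\<integral>\<^sup>+y. ennreal (L powr r) + ennreal (L powr (r - p)) *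
        ennreal (holder_quotient \<alpha> u x y powr p) \<partial>lebesgue_on \<Omega>) \<partial>lebesgue_on \<Omega>) =
        (\<integral>\<^sup>+x. ennreal (L powr r) * ennreal (measure lebesgue \<Omega>) + ennreal (L powr (r - p)) * J x \<partial>lebesgue_on \<Omega>)"
    proof (rule nn_integral_cong)
      fix x assume [measurable]: "x \<in> space (lebesgue_on \<Omega>)"
      show "(\<integral>\<^sup>+y. ennreal (L powr r) + ennreal (L powr (r - p)) *
          ennreal (holder_quotient \<alpha> u x y powr p) \<partial>lebesgue_on \<Omega>) =
          ennreal (L powr r) * ennreal (measure lebesgue \<Omega>) + ennreal (L powr (r - p)) * J x"
        unfolding J_def by (subst nn_integral_add, measurable) (simp add: nn_integral_cmult \<mu>)
    qed
    also have "\<dots> = ennreal (L powr r) * ennreal (measure lebesgue \<Omega>) * ennreal (measure lebesgue \<Omega>) +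
        ennreal (L powr (r - p)) * (\<integral>\<^sup>+x. J x \<partial>lebesgue_on \<Omega>)"
      by (subst nn_integral_add, measurable) (simp add: nn_integral_cmult \<mu>)
    finally show ?thesis
      by (simp add: J_def frac_energy_def power2_eq_square ennreal_mult mult.assoc)
  qed
  also have "\<dots> \<le> ennreal (L powr r * (measure lebesgue \<Omega>)\<^sup>2) + ennreal (L powr (r - p)) * ennreal (L powr p)"
    by (intro add_left_mono mult_left_mono I) auto
  also have "\<dots> = ennreal (L powr r * (measure lebesgue \<Omega>)\<^sup>2 + L powr (r - p) * L powr p)"
    by (simp add: ennreal_mult)
  also have "L powr (r - p) * L powr p = L powr r" by (simp add: powr_add[symmetric])
  finally show ?thesis by (simp add: distrib_left)
qed

text \<open>\<open>le_eps_plus_powr\<close> is applied to the difference of values for x in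
  \<open>A\<close> and y in \<open>B\<close>. Its r-th power is the energy integrand times |x -
  y|^(\<alpha> r), and |x - y| is at most \<open>d\<close>. Division by both measures leaves
  \<open>e\<close> and a multiple of the energy; \<open>e\<close> is chosen once the scale is
  known.\<close>

lemma average_diff_le_energy:
  fixes u :: "'a::euclidean_space \<Rightarrow> real"
  assumes \<Omega>: "open \<Omega>" "bounded \<Omega>" and u: "integrable (lebesgue_on \<Omega>) u"
    and A: "A \<in> sets (lebesgue_on \<Omega>)" "0 < measure (lebesgue_on \<Omega>) A"
    and B: "B \<in> sets (lebesgue_on \<Omega>)" "0 < measure (lebesgue_on \<Omega>) B"
    and d: "\<And>x y. x \<in> A \<Longrightarrow> y \<in> B \<Longrightarrow> norm (x - y) \<le> d"
    and "0 < \<alpha>" "1 \<le> r" "0 < e" "0 \<le> K" and K: "frac_energy \<alpha> r \<Omega> u \<le> ennreal K"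
  shows "\<bar>average (lebesgue_on \<Omega>) A u - average (lebesgue_on \<Omega>) B u\<bar> \<le>
    e + e powr (1 - r) * d powr (\<alpha> * r) * K / (measure (lebesgue_on \<Omega>) A * measure (lebesgue_on \<Omega>) B)"
proof -
  let ?M = "lebesgue_on \<Omega>"
  interpret finite_measure ?M using \<Omega> by (rule finite_measure_lebesgue_on_open)
  have [measurable]: "u \<in> borel_measurable ?M" "A \<in> sets ?M" "B \<in> sets ?M" using u A B by auto
  define C where "C = e powr (1 - r) * d powr (\<alpha> * r)"
  have C: "0 \<le> C" by (simp add: C_def)
  have pt: "indicator A x * indicator B y * \<bar>u x - u y\<bar> \<le>
      e * (indicator A x * indicator B y) + C * holder_quotient \<alpha> u x y powr r" for x y
  proof (cases "x \<in> A \<and> y \<in> B")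
    case True
    have "\<bar>u x - u y\<bar> \<le> e + e powr (1 - r) * \<bar>u x - u y\<bar> powr r"
      using assms by (intro le_eps_plus_powr) auto
    also have "\<bar>u x - u y\<bar> = norm (x - y) powr \<alpha> * holder_quotient \<alpha> u x y"
      by (simp add: holder_quotient_def)
    also have "\<dots> powr r = norm (x - y) powr (\<alpha> * r) * holder_quotient \<alpha> u x y powr r"
      by (simp add: powr_mult powr_powr)
    also have "e + e powr (1 - r) * \<dots> \<le> e + e powr (1 - r) * (d powr (\<alpha> * r) * holder_quotient \<alpha> u x y powr r)"
      using True d assms by (intro add_left_mono mult_left_mono mult_right_mono powr_mono2) auto
    finally show ?thesis
      using True \<open>0 < e\<close> by (cases "x = y") (auto simp: holder_quotient_def C_def mult.assoc)
  qed (use C in auto)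
  have "ennreal (\<bar>average ?M A u - average ?M B u\<bar> * measure ?M A * measure ?M B) \<le>
      (\<integral>\<^sup>+x. (\<integral>\<^sup>+y. ennreal (indicator A x * indicator B y * \<bar>u x - u y\<bar>) \<partial>?M) \<partial>?M)"
    by (intro average_diff_le u A B finite_measure_axioms)
  also have "\<dots> \<le> (\<integral>\<^sup>+x. (\<integral>\<^sup>+y. ennreal e * indicator A x * indicator B y + ennreal C *
      ennreal (holder_quotient \<alpha> u x y powr r) \<partial>?M) \<partial>?M)"
  proof (intro nn_integral_mono)
    fix x y
    have "ennreal e * indicator A x * indicator B y + ennreal C * ennreal (holder_quotient \<alpha> u x y powr r) =
        ennreal (e * (indicator A x * indicator B y) + C * holder_quotient \<alpha> u x y powr r)"
      using C \<open>0 < e\<close> by (auto simp: ennreal_mult indicator_def)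
    then show "ennreal (indicator A x * indicator B y * \<bar>u x - u y\<bar>) \<le> ennreal e * indicator A x * indicator B y +
        ennreal C * ennreal (holder_quotient \<alpha> u x y powr r)"
      using pt[of x y] by (simp add: ennreal_leI)
  qed
  also have "\<dots> = (\<integral>\<^sup>+x. ennreal e * emeasure ?M B * indicator A x + ennreal C *
      (\<integral>\<^sup>+y. ennreal (holder_quotient \<alpha> u x y powr r) \<partial>?M) \<partial>?M)"
  proof (rule nn_integral_cong)
    fix x assume [measurable]: "x \<in> space ?M"
    show "(\<integral>\<^sup>+y. ennreal e * indicator A x * indicator B y + ennreal C *
        ennreal (holder_quotient \<alpha> u x y powr r) \<partial>?M) = ennreal e * emeasure ?M B * indicator A x +
        ennreal C * (\<integral>\<^sup>+y. ennreal (holder_quotient \<alpha> u x y powr r) \<partial>?M)"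
      by (subst nn_integral_add, measurable)
        (simp add: nn_integral_cmult nn_integral_cmult_indicator mult.commute mult.left_commute)
  qed
  also have "\<dots> = ennreal e * emeasure ?M A * emeasure ?M B + ennreal C * frac_energy \<alpha> r \<Omega> u"
  proof -
    define J where "J = (\<lambda>x. \<integral>\<^sup>+y. ennreal (holder_quotient \<alpha> u x y powr r) \<partial>?M)"
    have [measurable]: "J \<in> borel_measurable ?M"
      unfolding J_def by (rule borel_measurable_nn_integral) measurable
    have "(\<integral>\<^sup>+x. ennreal e * emeasure ?M B * indicator A x + ennreal C * J x \<partial>?M) =
        ennreal e * emeasure ?M B * emeasure ?M A + ennreal C * (\<integral>\<^sup>+x. J x \<partial>?M)"
      by (simp add: nn_integral_add nn_integral_cmult nn_integral_cmult_indicator)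
    then show ?thesis by (simp add: J_def frac_energy_def mult.commute mult.left_commute)
  qed
  also have "\<dots> \<le> ennreal e * emeasure ?M A * emeasure ?M B + ennreal C * ennreal K"
    by (intro add_left_mono mult_left_mono K) auto
  also have "\<dots> = ennreal (e * measure ?M A * measure ?M B + C * K)"
    using \<open>0 < e\<close> C \<open>0 \<le> K\<close> by (simp add: emeasure_eq_measure ennreal_mult)
  finally have "\<bar>average ?M A u - average ?M B u\<bar> * measure ?M A * measure ?M B \<le>
      e * measure ?M A * measure ?M B + C * K"
    using C \<open>0 < e\<close> \<open>0 \<le> K\<close> by (subst (asm) ennreal_le_iff) auto
  then have "\<bar>average ?M A u - average ?M B u\<bar> \<le>
      (e * measure ?M A * measure ?M B + C * K) / (measure ?M A * measure ?M B)"
    using A B by (simp add: le_divide_eq mult.assoc)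
  also have "\<dots> = e + C * K / (measure ?M A * measure ?M B)"
    using A B by (simp add: add_divide_distrib)
  finally show ?thesis by (simp add: C_def)
qed

section \<open>Averages along an interior cone\<close>

lemma average_close:
  assumes "finite_measure M" "A \<in> sets M" "0 < measure M A" "integrable M f"
    and "\<And>x. x \<in> A \<Longrightarrow> \<bar>f x - c\<bar> \<le> e" "0 \<le> e"
  shows "\<bar>average M A f - c\<bar> \<le> e"
proof -
  interpret finite_measure M by fact
  have "ennreal (\<bar>average M A f - c\<bar> * measure M A) \<le> (\<integral>\<^sup>+x. ennreal (indicator A x * \<bar>f x - c\<bar>) \<partial>M)"
    by (intro average_diff_const_le assms)
  also have "\<dots> \<le> (\<integral>\<^sup>+x. ennreal e * indicator A x \<partial>M)"
    by (intro nn_integral_mono) (auto simp: indicator_def assms ennreal_leI)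
  also have "\<dots> = ennreal (e * measure M A)"
    using assms by (simp add: nn_integral_cmult_indicator emeasure_eq_measure ennreal_mult)
  finally show ?thesis using assms by (simp add: ennreal_le_iff)
qed

text \<open>Encoded by balls because averages are taken over balls: for \<open>\<kappa> < 1\<close>
  they sweep out a cone with vertex \<open>x0\<close>, axis \<open>e\<close> and a rounded cap. The
  bound \<open>\<kappa> \<le> 1\<close> keeps the ball at height \<open>t\<close> within distance
  \<open>2 * t\<close> of \<open>x0\<close>.\<close>

definition interior_cone_at :: "'a::euclidean_space set \<Rightarrow> 'a \<Rightarrow> 'a \<Rightarrow> real \<Rightarrow> real \<Rightarrow> bool" where
  "interior_cone_at \<Omega> x0 e \<kappa> t0 \<longleftrightarrow> norm e = 1 \<and> 0 < \<kappa> \<and> \<kappa> \<le> 1 \<and> 0 < t0 \<and>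
     (\<forall>t. 0 < t \<and> t \<le> t0 \<longrightarrow> ball (x0 + t *\<^sub>R e) (\<kappa> * t) \<subseteq> \<Omega>)"

definition cone_ball :: "'a::euclidean_space \<Rightarrow> 'a \<Rightarrow> real \<Rightarrow> real \<Rightarrow> nat \<Rightarrow> 'a set" where
  "cone_ball x0 e \<kappa> t0 k = ball (x0 + (t0 / 2 ^ k) *\<^sub>R e) (\<kappa> * (t0 / 2 ^ k))"

text \<open>Moving up by t along the axis and then by a vector w raises the graph by at most C |w|
  and lowers the height by at most |w|, so the point stays above the graph while (1 + C) |w| < t.
  This gives the aperture \<open>1 / (1 + C)\<close>; the height \<open>r / 2\<close> keeps all
  balls inside \<open>ball x0 r\<close>.\<close>

lemma lipschitz_boundary_interior_cone:
  fixes \<Omega> :: "'a::euclidean_space set"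
  assumes "lipschitz_boundary \<Omega>" "x0 \<in> frontier \<Omega>"
  obtains e \<kappa> t0 where "interior_cone_at \<Omega> x0 e \<kappa> t0"
proof -
  obtain r e C \<gamma> where r: "0 < r" and e: "norm e = 1" and lip: "lipschitz_on C {y. y \<bullet> e = 0} \<gamma>"
    and \<Omega>: "\<Omega> \<inter> ball x0 r = {x \<in> ball x0 r. \<gamma> (x - (x \<bullet> e) *\<^sub>R e) < x \<bullet> e}"
    using bspec[OF assms(1)[unfolded lipschitz_boundary_def] assms(2)] by blast
  define P where "P x = x - (x \<bullet> e) *\<^sub>R e" for x
  have ee: "e \<bullet> e = 1" using e by (simp add: norm_eq_1)
  have C: "0 \<le> C" using lip by (simp add: lipschitz_on_def)
  have normP: "norm (P x) \<le> norm x" for x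
  proof -
    have "(norm (P x))\<^sup>2 = (norm x)\<^sup>2 - (x \<bullet> e)\<^sup>2"
      unfolding power2_norm_eq_inner P_def
      by (simp add: inner_diff_left inner_diff_right ee inner_commute[of e x] power2_eq_square)
    then have "(norm (P x))\<^sup>2 \<le> (norm x)\<^sup>2" by simp
    then show ?thesis by (rule power2_le_imp_le) simp
  qed
  have Pdiff: "P x - P y = P (x - y)" for x y
    by (simp add: P_def inner_diff_left scaleR_diff_left)
  have \<gamma>: "\<bar>\<gamma> (P x) - \<gamma> (P y)\<bar> \<le> C * norm (P (x - y))" for x y
  proof -
    have "P x \<in> {y. y \<bullet> e = 0}" "P y \<in> {y. y \<bullet> e = 0}"
      by (simp_all add: P_def inner_diff_left ee)
    then show ?thesis using lip unfolding lipschitz_on_def dist_norm Pdiff[symmetric] by force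
  qed
  \<comment> \<open>\<open>x0\<close> is a limit of points above the graph, and a move by a distance
    s changes the gap between graph and height by at most (1 + C) s. Hence the radius used
    below.\<close>
  have x0: "\<gamma> (P x0) \<le> x0 \<bullet> e"
  proof (rule ccontr)
    assume "\<not> \<gamma> (P x0) \<le> x0 \<bullet> e"
    then have "0 < min r ((\<gamma> (P x0) - x0 \<bullet> e) / (1 + C))" using r C by simp
    moreover have "x0 \<in> closure \<Omega>" using assms by (simp add: frontier_def)
    ultimately obtain y where y: "y \<in> \<Omega>" "dist y x0 < min r ((\<gamma> (P x0) - x0 \<bullet> e) / (1 + C))"
      unfolding closure_approachable by blast
    then have "y \<in> \<Omega> \<inter> ball x0 r" by (simp add: dist_commute)
    then have "\<gamma> (P y) < y \<bullet> e" unfolding \<Omega> P_def by simp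
    moreover have "\<gamma> (P x0) - \<gamma> (P y) \<le> C * norm (y - x0)"
      using \<gamma>[of y x0] mult_left_mono[OF normP[of "y - x0"] C] by linarith
    moreover have "y \<bullet> e - x0 \<bullet> e \<le> norm (y - x0)"
      using norm_cauchy_schwarz[of "y - x0" e] e by (simp add: inner_diff_left)
    moreover have "norm (y - x0) * (1 + C) < \<gamma> (P x0) - x0 \<bullet> e"
      using y(2) C by (simp add: less_divide_eq dist_norm)
    ultimately show False by (simp add: algebra_simps)
  qed
  have "ball (x0 + t *\<^sub>R e) (1 / (1 + C) * t) \<subseteq> \<Omega>" if t: "0 < t" "t \<le> r / 2" for t
  proof
    fix z assume "z \<in> ball (x0 + t *\<^sub>R e) (1 / (1 + C) * t)"
    define w where "w = z - (x0 + t *\<^sub>R e)"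
    have w: "norm w < 1 / (1 + C) * t"
      using \<open>z \<in> _\<close> by (simp add: w_def dist_norm norm_minus_commute)
    have "1 / (1 + C) * t \<le> 1 * t" using C t by (intro mult_right_mono) auto
    then have wt: "norm w < t" using w by simp
    have "norm (z - x0) \<le> norm w + norm (t *\<^sub>R e)"
      using norm_triangle_ineq[of w "t *\<^sub>R e"] by (simp add: w_def)
    then have "norm (z - x0) < r" using wt t e by simp
    then have zb: "z \<in> ball x0 r" by (simp add: dist_norm norm_minus_commute)
    have "P (z - x0) = P w"
      by (simp add: w_def P_def algebra_simps ee)
    then have "\<gamma> (P z) \<le> \<gamma> (P x0) + C * norm w"
      using \<gamma>[of z x0] mult_left_mono[OF normP[of w] C] by simp
    moreover have "z \<bullet> e = x0 \<bullet> e + t + w \<bullet> e" by (simp add: w_def algebra_simps ee)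
    moreover have "- norm w \<le> w \<bullet> e" using Cauchy_Schwarz_ineq2[of w e] e by simp
    moreover have "norm w * (1 + C) < t" using w C by (simp add: less_divide_eq)
    ultimately have "\<gamma> (P z) < z \<bullet> e" using x0 by (simp add: algebra_simps)
    then have "z \<in> \<Omega> \<inter> ball x0 r" unfolding \<Omega> P_def[symmetric] using zb by simp
    then show "z \<in> \<Omega>" by simp
  qed
  then have "interior_cone_at \<Omega> x0 e (1 / (1 + C)) (r / 2)"
    unfolding interior_cone_at_def using e C r by auto
  then show ?thesis by (rule that)
qed

context
  fixes \<Omega> :: "'a::euclidean_space set" and x0 e :: 'a and \<kappa> t0 :: real
  assumes \<Omega>: "open \<Omega>" "bounded \<Omega>" and cone: "interior_cone_at \<Omega> x0 e \<kappa> t0"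
begin

lemma cone_ball_subset: "cone_ball x0 e \<kappa> t0 k \<subseteq> \<Omega>"
proof -
  have "t0 / 2 ^ k \<le> t0 / 1" using cone unfolding interior_cone_at_def
    by (intro divide_left_mono) auto
  moreover have "\<forall>t. 0 < t \<and> t \<le> t0 \<longrightarrow> ball (x0 + t *\<^sub>R e) (\<kappa> * t) \<subseteq> \<Omega>" "0 < t0"
    using cone by (simp_all add: interior_cone_at_def)
  ultimately show ?thesis unfolding cone_ball_def by (metis divide_pos_pos div_by_1 zero_less_numeral zero_less_power)
qed

lemma cone_ball_sets: "cone_ball x0 e \<kappa> t0 k \<in> sets (lebesgue_on \<Omega>)"
  using cone_ball_subset \<Omega> by (auto simp: sets_restrict_space_iff) (simp add: cone_ball_def)

lemma measure_cone_ball: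
  "measure (lebesgue_on \<Omega>) (cone_ball x0 e \<kappa> t0 k) = unit_ball_vol (DIM('a)) * (\<kappa> * (t0 / 2 ^ k)) ^ DIM('a)"
proof -
  have "measure (lebesgue_on \<Omega>) (cone_ball x0 e \<kappa> t0 k) = measure lebesgue (cone_ball x0 e \<kappa> t0 k)"
    using \<Omega> cone_ball_subset by (intro measure_restrict_space) auto
  then show ?thesis using cone by (simp add: cone_ball_def interior_cone_at_def content_ball)
qed

lemma measure_cone_ball_pos: "0 < measure (lebesgue_on \<Omega>) (cone_ball x0 e \<kappa> t0 k)"
  using cone by (simp add: measure_cone_ball interior_cone_at_def)

lemma cone_ball_near:
  assumes "x \<in> cone_ball x0 e \<kappa> t0 k"
  shows "norm (x - x0) < 2 * (t0 / 2 ^ k)"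
proof -
  let ?t = "t0 / 2 ^ k"
  have t: "0 < ?t" "0 < t0" "norm e = 1" "\<kappa> \<le> 1" using cone by (simp_all add: interior_cone_at_def)
  have "norm (x - x0) \<le> norm (x - (x0 + ?t *\<^sub>R e)) + norm (?t *\<^sub>R e)"
    using norm_triangle_ineq[of "x - (x0 + ?t *\<^sub>R e)" "?t *\<^sub>R e"] by simp
  also have "norm (?t *\<^sub>R e) = ?t" using t by simp
  also have "norm (x - (x0 + ?t *\<^sub>R e)) < \<kappa> * ?t"
    using assms by (simp add: cone_ball_def dist_norm norm_minus_commute)
  also have "\<kappa> * ?t \<le> 1 * ?t" using t by (intro mult_right_mono) auto
  finally show ?thesis by simp
qed

lemma average_cone_ball_tendsto:
  assumes u: "continuous_on (closure \<Omega>) u" and x0: "x0 \<in> closure \<Omega>"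
  shows "(\<lambda>k. average (lebesgue_on \<Omega>) (cone_ball x0 e \<kappa> t0 k) u) \<longlonglongrightarrow> u x0"
proof (rule tendstoI)
  fix \<epsilon> :: real assume "0 < \<epsilon>"
  then obtain d where d: "0 < d" "\<And>x. x \<in> closure \<Omega> \<Longrightarrow> dist x x0 < d \<Longrightarrow> dist (u x) (u x0) < \<epsilon> / 2"
    using u x0 unfolding continuous_on_iff by (meson half_gt_zero)
  have "(\<lambda>k. 2 * (t0 * (1 / 2) ^ k)) \<longlonglongrightarrow> 2 * (t0 * 0)"
    by (intro tendsto_intros LIMSEQ_power_zero) auto
  then have "\<forall>\<^sub>F k in sequentially. 2 * (t0 * (1 / 2) ^ k) < d"
    using d(1) by (intro order_tendstoD) auto
  then show "\<forall>\<^sub>F k in sequentially. dist (average (lebesgue_on \<Omega>) (cone_ball x0 e \<kappa> t0 k) u) (u x0) < \<epsilon>"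
  proof eventually_elim
    case (elim k)
    have "\<bar>average (lebesgue_on \<Omega>) (cone_ball x0 e \<kappa> t0 k) u - u x0\<bar> \<le> \<epsilon> / 2"
    proof (rule average_close)
      fix x assume x: "x \<in> cone_ball x0 e \<kappa> t0 k"
      then have "x \<in> closure \<Omega>" using cone_ball_subset closure_subset by blast
      moreover have "dist x x0 < d" using cone_ball_near[OF x] elim by (simp add: dist_norm power_divide)
      ultimately show "\<bar>u x - u x0\<bar> \<le> \<epsilon> / 2" using d(2)[of x] by (simp add: dist_real_def)
    qed (use \<Omega> u \<open>0 < \<epsilon>\<close> cone_ball_sets measure_cone_ball_pos in
        \<open>auto intro: finite_measure_lebesgue_on_open integrable_continuous_closure\<close>)
    then show ?case using \<open>0 < \<epsilon>\<close> by (simp add: dist_real_def)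
  qed
qed

text \<open>A Morrey estimate at a single point: the averages over consecutive balls differ by a geometric term
  because \<open>\<alpha> r\<close> exceeds twice the dimension.\<close>

lemma average_cone_ball_rate:
  assumes "0 < \<alpha>" "1 \<le> r" "2 * real (DIM('a)) < \<alpha> * r" "0 \<le> K" and x0: "x0 \<in> closure \<Omega>"
  obtains D \<theta> where "0 \<le> \<theta>" "\<theta> < 1"
    "\<And>u k. continuous_on (closure \<Omega>) u \<Longrightarrow> frac_energy \<alpha> r \<Omega> u \<le> ennreal K \<Longrightarrow>
       \<bar>average (lebesgue_on \<Omega>) (cone_ball x0 e \<kappa> t0 k) u - u x0\<bar> \<le> D * \<theta> ^ k"
proof -
  let ?N = "DIM('a)"
  let ?M = "lebesgue_on \<Omega>"
  let ?V = "unit_ball_vol (real ?N)"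
  \<comment> \<open>The Morrey exponent, positive because \<alpha> r > 2N. The radii halve from one
    ball to the next, so a term of order t^\<delta> is geometric with ratio 2^(-\<delta>).\<close>
  define \<delta> where "\<delta> = \<alpha> - 2 * real ?N / r"
  define \<theta> where "\<theta> = 2 powr (- \<delta>)"
  have \<delta>: "0 < \<delta>" "\<delta> * r = \<alpha> * r - 2 * real ?N" using assms by (simp_all add: \<delta>_def field_simps)
  have \<theta>: "0 \<le> \<theta>" "\<theta> < 1" using \<delta> by (simp_all add: \<theta>_def powr_less_one)
  have pos: "0 < \<kappa>" "0 < t0" using cone by (simp_all add: interior_cone_at_def)
  have V: "0 < ?V" by simp
  \<comment> \<open>The factor \<open>4\<close> comes from the distance bound \<open>4 * t\<close>,
    the denominator from the volumes of the two balls, and \<open>2 ^ ?N\<close> from the second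
    ball having half the radius.\<close>
  define C where "C = 4 powr (\<alpha> * r) * K * 2 ^ ?N / (?V\<^sup>2 * \<kappa> ^ (2 * ?N))"
  have C: "0 \<le> C" using pos V \<open>0 \<le> K\<close> by (simp add: C_def)
  have step: "\<bar>average ?M (cone_ball x0 e \<kappa> t0 k) u - average ?M (cone_ball x0 e \<kappa> t0 (Suc k)) u\<bar> \<le>
      ((1 + C) * t0 powr \<delta>) * \<theta> ^ k"
    if u: "continuous_on (closure \<Omega>) u" "frac_energy \<alpha> r \<Omega> u \<le> ennreal K" for u k
  proof -
    define t where "t = t0 / 2 ^ k"
    have t: "0 < t" "t0 / 2 ^ Suc k = t / 2" using pos by (simp_all add: t_def)
    \<comment> \<open>The threshold is t^\<delta>. It balances the two terms: the exponent of t in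
      the second is \<delta> (1 - r) + \<alpha> r - 2N, which is again \<delta>.\<close>
    have "\<bar>average ?M (cone_ball x0 e \<kappa> t0 k) u - average ?M (cone_ball x0 e \<kappa> t0 (Suc k)) u\<bar> \<le>
      t powr \<delta> + (t powr \<delta>) powr (1 - r) * (4 * t) powr (\<alpha> * r) * K /
        (measure ?M (cone_ball x0 e \<kappa> t0 k) * measure ?M (cone_ball x0 e \<kappa> t0 (Suc k)))"
    proof (rule average_diff_le_energy)
      fix x y assume "x \<in> cone_ball x0 e \<kappa> t0 k" "y \<in> cone_ball x0 e \<kappa> t0 (Suc k)"
      then have "norm (x - x0) < 2 * t" "norm (y - x0) < t"
        using cone_ball_near[of x k] cone_ball_near[of y "Suc k"] t by (simp_all add: t_def)
      then show "norm (x - y) \<le> 4 * t"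
        using norm_triangle_ineq4[of "x - x0" "y - x0"] t by simp
    qed (use assms u t \<Omega> cone_ball_sets measure_cone_ball_pos in \<open>auto intro: integrable_continuous_closure\<close>)
    also have "(t powr \<delta>) powr (1 - r) * (4 * t) powr (\<alpha> * r) * K /
        (measure ?M (cone_ball x0 e \<kappa> t0 k) * measure ?M (cone_ball x0 e \<kappa> t0 (Suc k))) =
        C * (t powr (\<delta> * (1 - r)) * t powr (\<alpha> * r) / t ^ (2 * ?N))"
      unfolding measure_cone_ball t_def[symmetric] t(2) C_def
      by (simp add: powr_powr powr_mult power_mult_distrib power_divide power_mult power2_eq_square
          power_mult[symmetric] mult_2 power_add mult_ac)
    also have "t ^ (2 * ?N) = t powr (2 * real ?N)" using t powr_realpow[of t "2 * ?N"] by simp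
    also have "t powr (\<delta> * (1 - r)) * t powr (\<alpha> * r) / t powr (2 * real ?N) =
        t powr (\<delta> * (1 - r) + \<alpha> * r - 2 * real ?N)"
      by (simp add: powr_add powr_diff)
    also have "\<delta> * (1 - r) + \<alpha> * r - 2 * real ?N = \<delta>" using \<delta>(2) by (simp add: algebra_simps)
    also have "t powr \<delta> = t0 powr \<delta> * \<theta> ^ k"
    proof -
      have "((2::real) ^ k) powr \<delta> = 2 powr (\<delta> * real k)"
        using powr_powr[of 2 "real k" \<delta>] by (simp add: powr_realpow mult.commute)
      moreover have "\<theta> ^ k = 2 powr (- (\<delta> * real k))"
        using powr_powr[of 2 "- \<delta>" "real k"] by (simp add: \<theta>_def powr_realpow)
      ultimately show ?thesis by (simp add: t_def powr_divide powr_minus_divide)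
    qed
    finally show ?thesis by (simp add: algebra_simps)
  qed
  \<comment> \<open>All constants are fixed before \<open>u\<close>, so the rate is uniform over the
    continuous functions with energy at most \<open>K\<close>.\<close>
  show ?thesis
  proof (rule that[OF \<theta>])
    fix u k assume u: "continuous_on (closure \<Omega>) u" "frac_energy \<alpha> r \<Omega> u \<le> ennreal K"
    show "\<bar>average ?M (cone_ball x0 e \<kappa> t0 k) u - u x0\<bar> \<le> (1 + C) * t0 powr \<delta> / (1 - \<theta>) * \<theta> ^ k"
      using step[OF u] \<theta> C by (intro geometric_telescope_bound average_cone_ball_tendsto u x0) auto
  qed
qed

end

section \<open>Limits of sequences with bounded energy\<close>

lemma filterlim_powr_at_top:
  fixes a :: real
  assumes "1 < a" "filterlim p at_top F"
  shows "filterlim (\<lambda>k. a powr p k) at_top F"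
proof -
  have "filterlim (\<lambda>k. ln a * p k) at_top F"
    using assms by (intro filterlim_tendsto_pos_mult_at_top[OF tendsto_const]) auto
  then show ?thesis
    using assms filterlim_compose[OF exp_at_top] by (simp add: powr_def mult.commute)
qed

text \<open>If l exceeded L, some m strictly between them would lie below s k eventually, and
  (m/L)^(p k) already tends to infinity. Here growing exponents turn an integral bound into a
  pointwise one.\<close>

lemma limit_le_if_powr_liminf_finite:
  fixes s p :: "nat \<Rightarrow> real"
  assumes "s \<longlonglongrightarrow> l" and p: "filterlim p at_top sequentially" and L: "0 < L"
    and fin: "liminf (\<lambda>k. ennreal ((s k / L) powr p k)) \<noteq> \<infinity>"
  shows "l \<le> L"
proof (rule ccontr)
  assume "\<not> l \<le> L"
  then obtain m where m: "L < m" "m < l" using dense[of L l] by auto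
  have "\<forall>\<^sub>F k in sequentially. (m / L) powr p k \<le> (s k / L) powr p k"
    using order_tendstoD(1)[OF assms(1) m(2)] filterlim_at_top_dense[THEN iffD1, OF p, rule_format, of 0]
  proof eventually_elim
    case (elim k)
    then show ?case using m L by (intro powr_mono2 divide_right_mono) auto
  qed
  then have "filterlim (\<lambda>k. (s k / L) powr p k) at_top sequentially"
    using m L by (intro filterlim_at_top_mono[OF filterlim_powr_at_top[OF _ p, of "m / L"]]) auto
  then have "(\<lambda>k. ennreal ((s k / L) powr p k)) \<longlonglongrightarrow> top"
    by (simp add: ennreal_tendsto_top_eq_at_top)
  then show False using fin by (simp add: lim_imp_Liminf)
qed

lemma AE_lebesgue_on_open_ex:
  fixes \<Omega> :: "'a::euclidean_space set"
  assumes "AE x in lebesgue_on \<Omega>. P x" "open \<Omega>" "open U" "U \<noteq> {}" "U \<subseteq> \<Omega>"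
  shows "\<exists>x\<in>U. P x"
proof (rule ccontr)
  assume neg: "\<not> (\<exists>x\<in>U. P x)"
  have "AE x in lebesgue. x \<in> \<Omega> \<longrightarrow> P x"
    using assms(1,2) by (subst (asm) AE_restrict_space_iff) auto
  then have "AE x in lebesgue. x \<notin> U" by (rule eventually_mono) (use neg assms in auto)
  then have "U \<in> null_sets lebesgue" using assms by (subst AE_iff_null_sets) auto
  then show False using assms open_not_negligible negligible_iff_null_sets by blast
qed

text \<open>The conclusion is iterated instead of being stated on the product, so that a good point
  \<open>x\<close> can later be fixed while almost every \<open>y\<close> stays available.\<close>

lemma AE_holder_quotient_limit:
  fixes u :: "'a::euclidean_space \<Rightarrow> real" and c :: "nat \<Rightarrow> 'a \<Rightarrow> real"
  assumes \<Omega>: "open \<Omega>" "bounded \<Omega>" and p: "filterlim p at_top sequentially" and "0 < \<alpha>" "0 < L"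
    and c [measurable]: "\<And>k. c k \<in> borel_measurable (lebesgue_on \<Omega>)"
    and lim: "AE x in lebesgue_on \<Omega>. (\<lambda>k. c k x) \<longlonglongrightarrow> u x"
    and bound: "\<And>k. frac_energy \<alpha> (p k) \<Omega> (c k) \<le> ennreal (L powr p k)"
  shows "AE x in lebesgue_on \<Omega>. AE y in lebesgue_on \<Omega>. \<bar>u x - u y\<bar> \<le> L * norm (x - y) powr \<alpha>"
proof -
  let ?M = "lebesgue_on \<Omega>"
  interpret finite_measure ?M using \<Omega> by (rule finite_measure_lebesgue_on_open)
  interpret pair_sigma_finite ?M ?M ..
  define H where "H k z = (case z of (x, y) \<Rightarrow> holder_quotient \<alpha> (c k) x y)" for k z
  have [measurable]: "H k \<in> borel_measurable (?M \<Otimes>\<^sub>M ?M)" for k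
    unfolding H_def using holder_quotient_measurable[OF c] by simp
  have H0: "0 \<le> H k z" for k z by (auto simp: H_def holder_quotient_nonneg split: prod.split)
  \<comment> \<open>Dividing by \<open>L\<close> inside the power makes the bound 1 for every
    \<open>k\<close>; \<open>L powr p k\<close> itself need not stay bounded.\<close>
  have le1: "(\<integral>\<^sup>+z. ennreal ((H k z / L) powr p k) \<partial>(?M \<Otimes>\<^sub>M ?M)) \<le> 1" for k
  proof -
    have "(\<integral>\<^sup>+z. ennreal ((H k z / L) powr p k) \<partial>(?M \<Otimes>\<^sub>M ?M)) =
        (\<integral>\<^sup>+z. ennreal (1 / L powr p k) * ennreal (H k z powr p k) \<partial>(?M \<Otimes>\<^sub>M ?M))"
      using \<open>0 < L\<close> by (intro nn_integral_cong) (simp add: powr_divide ennreal_mult[symmetric])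
    also have "\<dots> = ennreal (1 / L powr p k) * frac_energy \<alpha> (p k) \<Omega> (c k)"
      using frac_energy_eq_pair[OF \<Omega> c, of \<alpha> k "p k"]
      by (subst nn_integral_cmult) (auto simp: H_def)
    also have "\<dots> \<le> ennreal (1 / L powr p k) * ennreal (L powr p k)"
      by (intro mult_left_mono bound) auto
    also have "\<dots> = 1" using \<open>0 < L\<close> by (simp add: ennreal_mult[symmetric])
    finally show ?thesis .
  qed
  have "(\<integral>\<^sup>+z. liminf (\<lambda>k. ennreal ((H k z / L) powr p k)) \<partial>(?M \<Otimes>\<^sub>M ?M)) \<le>
      liminf (\<lambda>k. \<integral>\<^sup>+z. ennreal ((H k z / L) powr p k) \<partial>(?M \<Otimes>\<^sub>M ?M))"
    by (rule nn_integral_liminf) measurable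
  also have "\<dots> \<le> liminf (\<lambda>k. 1::ennreal)" by (intro Liminf_mono always_eventually allI le1)
  also have "\<dots> = 1" by (simp add: Liminf_const)
  finally have "AE z in ?M \<Otimes>\<^sub>M ?M. liminf (\<lambda>k. ennreal ((H k z / L) powr p k)) \<noteq> \<infinity>"
    by (intro nn_integral_PInf_AE) (auto simp: top_unique)
  then have "AE x in ?M. AE y in ?M. liminf (\<lambda>k. ennreal ((H k (x, y) / L) powr p k)) \<noteq> \<infinity>"
    by (rule AE_pair)
  then show ?thesis using lim
  proof eventually_elim
    case (elim x)
    show ?case using elim(1) lim
    proof eventually_elim
      case (elim y)
      show ?case
      proof (cases "x = y")
        case False
        have "(\<lambda>k. holder_quotient \<alpha> (c k) x y) \<longlonglongrightarrow> holder_quotient \<alpha> u x y"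
          unfolding holder_quotient_def using \<open>(\<lambda>k. c k x) \<longlonglongrightarrow> u x\<close> elim(2) False
          by (intro tendsto_intros) auto
        then have "holder_quotient \<alpha> u x y \<le> L"
          by (rule limit_le_if_powr_liminf_finite[OF _ p \<open>0 < L\<close>]) (use elim(1) in \<open>simp add: H_def\<close>)
        then show ?thesis using \<open>0 < L\<close> by (simp add: holder_quotient_le_iff)
      qed simp
    qed
  qed
qed

text \<open>Two good points x and z need not be directly comparable, but almost every y is
  comparable with both. A choice of y close to z gives the inequality for x and z up to an
  arbitrarily small error, with the same constant \<open>L\<close>.\<close>

lemma AE_holder_imp_holder_representative:
  fixes u :: "'a::euclidean_space \<Rightarrow> real"
  assumes \<Omega>: "open \<Omega>" and \<alpha>: "0 < \<alpha>" "\<alpha> \<le> 1" and L: "0 < L"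
    and ae: "AE x in lebesgue_on \<Omega>. AE y in lebesgue_on \<Omega>. \<bar>u x - u y\<bar> \<le> L * norm (x - y) powr \<alpha>"
  obtains v where "holder_on \<alpha> L UNIV v" "AE x in lebesgue_on \<Omega>. u x = v x"
proof -
  define G where "G = {x \<in> \<Omega>. AE y in lebesgue_on \<Omega>. \<bar>u x - u y\<bar> \<le> L * norm (x - y) powr \<alpha>}"
  have "holder_on \<alpha> L G u"
    unfolding holder_on_def
  proof (intro ballI, rule field_le_epsilon)
    fix x z and \<eta> :: real assume xz: "x \<in> G" "z \<in> G" and \<eta>: "0 < \<eta>"
    \<comment> \<open>Makes \<open>L * \<epsilon> powr \<alpha>\<close> equal to
      \<open>\<eta> / 2\<close>. The error at \<open>y\<close> is counted twice, once directly and
      once through the triangle inequality for \<open>norm (x - y) powr \<alpha>\<close>.\<close>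
    define \<epsilon> where "\<epsilon> = (\<eta> / (2 * L)) powr (1 / \<alpha>)"
    have \<epsilon>: "0 < \<epsilon>" "\<epsilon> powr \<alpha> = \<eta> / (2 * L)" using \<eta> L \<alpha> by (simp_all add: \<epsilon>_def powr_powr)
    have ae_xz: "AE y in lebesgue_on \<Omega>. \<bar>u x - u y\<bar> \<le> L * norm (x - y) powr \<alpha> \<and> \<bar>u z - u y\<bar> \<le> L * norm (z - y) powr \<alpha>"
      using xz by (auto simp: G_def)
    have "\<Omega> \<inter> ball z \<epsilon> \<noteq> {}" using xz \<epsilon> centre_in_ball by (force simp: G_def)
    then obtain y where y: "y \<in> ball z \<epsilon>"
      "\<bar>u x - u y\<bar> \<le> L * norm (x - y) powr \<alpha>" "\<bar>u z - u y\<bar> \<le> L * norm (z - y) powr \<alpha>"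
      using AE_lebesgue_on_open_ex[OF ae_xz \<Omega>, of "\<Omega> \<inter> ball z \<epsilon>"] \<Omega> by blast
    have "norm (z - y) powr \<alpha> \<le> \<epsilon> powr \<alpha>"
      using y(1) \<alpha> by (intro powr_mono2) (auto simp: dist_norm)
    then have zy: "L * norm (z - y) powr \<alpha> \<le> \<eta> / 2"
      using \<epsilon>(2) L mult_left_mono[of "norm (z - y) powr \<alpha>" "\<eta> / (2 * L)" L] by simp
    have "L * norm (x - y) powr \<alpha> \<le> L * (norm (x - z) powr \<alpha> + norm (z - y) powr \<alpha>)"
      using L \<alpha> by (intro mult_left_mono norm_diff_powr_triangle) auto
    then show "\<bar>u x - u z\<bar> \<le> L * norm (x - z) powr \<alpha> + \<eta>"
      using y(2,3) zy by (simp add: distrib_left)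
  qed
  then obtain v where v: "holder_on \<alpha> L UNIV v" "\<And>x. x \<in> G \<Longrightarrow> v x = u x"
    using holder_on_extension[of \<alpha> L G u] L \<alpha> by auto
  have "AE x in lebesgue_on \<Omega>. u x = v x"
    using ae AE_space by eventually_elim (simp add: v(2) G_def)
  with v(1) show ?thesis by (rule that)
qed

section \<open>Boundary values under convergence in the mean\<close>

lemma average_tendsto_L1:
  assumes "A \<in> sets M" and f: "\<And>k. integrable M (f k)" "integrable M g"
    and L1: "(\<lambda>k. \<integral>\<^sup>+x. ennreal \<bar>f k x - g x\<bar> \<partial>M) \<longlonglongrightarrow> 0"
  shows "(\<lambda>k. average M A (f k)) \<longlonglongrightarrow> average M A g"
proof -
  have i: "integrable M (\<lambda>x. indicator A x * h x)" if "integrable M h" for h :: "_ \<Rightarrow> real"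
    using integrable_real_mult_indicator[OF assms(1) that] by (simp add: mult.commute)
  have "(\<lambda>k. \<integral>\<^sup>+x. norm (indicator A x * f k x - indicator A x * g x) \<partial>M) \<longlonglongrightarrow> 0"
  proof (rule tendsto_sandwich[OF _ _ tendsto_const L1])
    show "\<forall>\<^sub>F k in sequentially. (\<integral>\<^sup>+x. norm (indicator A x * f k x - indicator A x * g x) \<partial>M) \<le>
        (\<integral>\<^sup>+x. ennreal \<bar>f k x - g x\<bar> \<partial>M)"
      by (intro always_eventually allI nn_integral_mono ennreal_leI) (simp add: indicator_def)
  qed simp
  then have "(\<lambda>k. LINT x|M. indicator A x * f k x) \<longlonglongrightarrow> (LINT x|M. indicator A x * g x)"
    by (intro tendsto_L1_int i f)
  then show ?thesis unfolding average_def divide_inverse by (intro tendsto_mult tendsto_const)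
qed

text \<open>Two limits in this order: first \<open>k\<close> on a fixed ball, where convergence in
  the mean carries the averages over, then the ball index, where the continuity of \<open>v\<close>
  takes over. The bound \<open>D * \<theta> ^ j\<close> survives the first limit because it does not
  depend on \<open>k\<close>.\<close>

lemma boundary_value_limit:
  fixes v :: "'a::euclidean_space \<Rightarrow> real" and c :: "nat \<Rightarrow> 'a \<Rightarrow> real"
  assumes \<Omega>: "open \<Omega>" "bounded \<Omega>" "lipschitz_boundary \<Omega>" and x0: "x0 \<in> frontier \<Omega>"
    and \<alpha>: "0 < \<alpha>" and r: "1 \<le> r" "2 * real (DIM('a)) < \<alpha> * r" "0 \<le> K"
    and c: "\<And>k. continuous_on (closure \<Omega>) (c k)" "\<And>k. c k x0 = b"
    and bound: "\<And>k. frac_energy \<alpha> r \<Omega> (c k) \<le> ennreal K"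
    and v: "continuous_on (closure \<Omega>) v"
    and L1: "(\<lambda>k. \<integral>\<^sup>+x. ennreal \<bar>c k x - v x\<bar> \<partial>lebesgue_on \<Omega>) \<longlonglongrightarrow> 0"
  shows "v x0 = b"
proof -
  let ?M = "lebesgue_on \<Omega>"
  obtain e \<kappa> t0 where cone: "interior_cone_at \<Omega> x0 e \<kappa> t0"
    using lipschitz_boundary_interior_cone[OF \<Omega>(3) x0] .
  have x0c: "x0 \<in> closure \<Omega>" using x0 by (simp add: frontier_def)
  let ?a = "\<lambda>f j. average ?M (cone_ball x0 e \<kappa> t0 j) f"
  obtain D \<theta> where \<theta>: "0 \<le> \<theta>" "\<theta> < 1" and rate: "\<And>k j. \<bar>?a (c k) j - c k x0\<bar> \<le> D * \<theta> ^ j"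
    using average_cone_ball_rate[OF \<Omega>(1,2) cone \<alpha> r x0c] c(1) bound by metis
  have "\<bar>?a v j - b\<bar> \<le> D * \<theta> ^ j" for j
  proof (rule LIMSEQ_le_const2)
    show "(\<lambda>k. \<bar>?a (c k) j - b\<bar>) \<longlonglongrightarrow> \<bar>?a v j - b\<bar>"
      by (intro tendsto_intros average_tendsto_L1 L1 cone_ball_sets[OF \<Omega>(1,2) cone]
          integrable_continuous_closure \<Omega> c v)
  qed (use rate c(2) in auto)
  moreover have "(\<lambda>j. D * \<theta> ^ j) \<longlonglongrightarrow> D * 0"
    using \<theta> by (intro tendsto_intros LIMSEQ_power_zero) auto
  moreover have "(\<lambda>j. \<bar>?a v j - b\<bar>) \<longlonglongrightarrow> \<bar>v x0 - b\<bar>"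
    by (intro tendsto_intros average_cone_ball_tendsto \<Omega> cone v x0c)
  ultimately have "\<bar>v x0 - b\<bar> \<le> D * 0" by (intro LIMSEQ_le) auto
  then show ?thesis by simp
qed

text \<open>\<open>le_eps_plus_powr\<close> with the norm a itself as threshold: since a^(1-q) a^q =
  a, the integrated bound is a times the measure plus a. The threshold must be positive, so norm
  zero is a separate case.\<close>

lemma nn_integral_abs_le_Lq_norm:
  fixes w :: "'a::euclidean_space \<Rightarrow> real"
  assumes \<Omega>: "open \<Omega>" "bounded \<Omega>" and w: "w \<in> Lq_functions q \<Omega>" and q: "1 \<le> q"
  shows "(\<integral>\<^sup>+x. ennreal \<bar>w x\<bar> \<partial>lebesgue_on \<Omega>) \<le> ennreal (Lq_norm q \<Omega> w * (measure (lebesgue_on \<Omega>) \<Omega> + 1))"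
proof (cases "Lq_norm q \<Omega> w = 0")
  case True
  then have "AE x in lebesgue_on \<Omega>. w x = 0" using Lq_norm_eq_0_iff[OF w] by simp
  then have "(\<integral>\<^sup>+x. ennreal \<bar>w x\<bar> \<partial>lebesgue_on \<Omega>) = (\<integral>\<^sup>+x. 0 \<partial>lebesgue_on \<Omega>)"
    by (intro nn_integral_cong_AE) (auto elim: eventually_mono)
  then show ?thesis using True by simp
next
  case False
  let ?M = "lebesgue_on \<Omega>"
  interpret finite_measure ?M using \<Omega> by (rule finite_measure_lebesgue_on_open)
  define a where "a = Lq_norm q \<Omega> w"
  have a: "0 < a" using False Lq_norm_nonneg[of q \<Omega> w] by (simp add: a_def)
  have int: "integrable ?M (\<lambda>x. \<bar>w x\<bar> powr q)" using w by (simp add: Lq_functions_def)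
  have int2: "integrable ?M (\<lambda>x. a + a powr (1 - q) * \<bar>w x\<bar> powr q)"
    using int by simp
  have "(\<integral>\<^sup>+x. ennreal \<bar>w x\<bar> \<partial>?M) \<le> (\<integral>\<^sup>+x. ennreal (a + a powr (1 - q) * \<bar>w x\<bar> powr q) \<partial>?M)"
    using a q by (intro nn_integral_mono ennreal_leI le_eps_plus_powr) auto
  also have "\<dots> = ennreal (LINT x|?M. a + a powr (1 - q) * \<bar>w x\<bar> powr q)"
    using a by (intro nn_integral_eq_integral int2) auto
  also have "(LINT x|?M. a + a powr (1 - q) * \<bar>w x\<bar> powr q) =
      a * measure ?M \<Omega> + a powr (1 - q) * (LINT x|?M. \<bar>w x\<bar> powr q)"
    using int by (simp add: mult.commute)
  also have "(LINT x|?M. \<bar>w x\<bar> powr q) = a powr q"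
    using q by (simp add: Lq_functions_norm_powr a_def)
  also have "a powr (1 - q) * a powr q = a" using a by (simp add: powr_add[symmetric])
  finally show ?thesis by (simp add: a_def distrib_left)
qed

section \<open>Gamma-convergence\<close>

lemma cont_rep_in:
  assumes "has_boundary_values \<Omega> \<phi> U"
  shows "cont_rep \<Omega> U \<in> cont_reps \<Omega> U"
  using assms unfolding has_boundary_values_def cont_rep_def by (simp add: some_in_eq)

lemma frac_seminorm_rep:
  assumes "open \<Omega>" "U \<in> L0 \<Omega>" "v \<in> U"
  shows "frac_seminorm \<alpha> p \<Omega> (rep U) = frac_seminorm \<alpha> p \<Omega> v"
  using assms rep_in[OF assms(2)] by (intro frac_seminorm_cong_AE L0_ae_eq) auto

text \<open>\<open>cont_rep\<close> is an arbitrary choice, but by \<open>cont_reps_unique\<close>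
  it agrees on the closure with every continuous member. One explicit Hoelder member with the right
  boundary values therefore decides both membership and bound.\<close>

lemma E_inf_le:
  assumes \<Omega>: "open \<Omega>" and U: "U \<in> L0 \<Omega>" "v \<in> U" and v: "holder_on \<alpha> L (closure \<Omega>) v"
    and \<phi>: "\<And>x. x \<in> frontier \<Omega> \<Longrightarrow> v x = \<phi> x" and "0 < \<alpha>" "0 \<le> L"
  shows "U \<in> X_inf \<alpha> \<Omega> \<phi>" "E_inf \<alpha> \<Omega> \<phi> U \<le> ennreal L"
proof -
  have vr: "v \<in> cont_reps \<Omega> U"
    using U holder_on_continuous[OF v \<open>0 < \<alpha>\<close>] by (simp add: cont_reps_def)
  then have "cont_rep \<Omega> U \<in> cont_reps \<Omega> U" unfolding cont_rep_def by (rule someI[of "\<lambda>w. w \<in> cont_reps \<Omega> U"])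
  then have eq: "cont_rep \<Omega> U x = v x" if "x \<in> closure \<Omega>" for x
    using cont_reps_unique[OF \<Omega> U(1) _ vr that] by blast
  have "has_boundary_values \<Omega> \<phi> U"
    unfolding has_boundary_values_def using vr eq \<phi> by (auto simp: frontier_def)
  moreover have le: "holder_seminorm \<alpha> (closure \<Omega>) (cont_rep \<Omega> U) \<le> ennreal L"
    using holder_seminorm_le_iff[OF \<open>0 \<le> L\<close>, of \<alpha> "closure \<Omega>" v] v holder_seminorm_cong[of "closure \<Omega>" "cont_rep \<Omega> U" v \<alpha>, OF eq]
    by simp
  moreover have "holder_seminorm \<alpha> (closure \<Omega>) (cont_rep \<Omega> U) < \<infinity>"
    using le by (rule order_le_less_trans) simp
  ultimately show "U \<in> X_inf \<alpha> \<Omega> \<phi>" using U by (simp add: X_inf_def)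
  then show "E_inf \<alpha> \<Omega> \<phi> U \<le> ennreal L" using le by (simp add: E_inf_def)
qed

lemma L0_eq_class:
  assumes "U \<in> L0 \<Omega>" "v \<in> U"
  shows "U = ae_eq \<Omega> `` {v}"
proof -
  obtain w where "U = ae_eq \<Omega> `` {w}" using assms(1) by (auto simp: L0_def quotient_def)
  then show ?thesis using assms(2) equiv_class_eq[OF equiv_ae_eq] by blast
qed

lemma L0_ae_eq_mem: "U \<in> L0 \<Omega> \<Longrightarrow> u \<in> U \<Longrightarrow> (u, v) \<in> ae_eq \<Omega> \<Longrightarrow> v \<in> U"
  using L0_eq_class by blast

lemma X_inf_nonempty:
  fixes \<Omega> :: "'a::euclidean_space set"
  assumes \<Omega>: "open \<Omega>" and \<alpha>: "0 < \<alpha>" "\<alpha> \<le> 1" and \<phi>: "\<phi> \<in> holder_space \<alpha> (frontier \<Omega>)"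
  shows "X_inf \<alpha> \<Omega> \<phi> \<noteq> {}"
proof -
  have "holder_seminorm \<alpha> (frontier \<Omega>) \<phi> < \<infinity>" using \<phi> by (simp add: holder_space_def)
  then obtain L where L: "0 \<le> L" "holder_on \<alpha> L (frontier \<Omega>) \<phi>"
    by (rule holder_seminorm_finiteE)
  obtain g where g: "holder_on \<alpha> L UNIV g" "\<And>x. x \<in> frontier \<Omega> \<Longrightarrow> g x = \<phi> x"
    using holder_on_extension[OF L(2,1) \<alpha>] by blast
  have "continuous_on \<Omega> g"
    using continuous_on_subset[OF holder_on_continuous[OF g(1) \<alpha>(1)]] by simp
  then have gm: "g \<in> borel_measurable (lebesgue_on \<Omega>)"
    using \<Omega> by (intro continuous_imp_measurable_on_sets_lebesgue) auto
  then have "(g, g) \<in> ae_eq \<Omega>" by (simp add: ae_eq_def)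
  moreover have "ae_eq \<Omega> `` {g} \<in> L0 \<Omega>" unfolding L0_def using gm by (rule quotientI)
  ultimately have "ae_eq \<Omega> `` {g} \<in> X_inf \<alpha> \<Omega> \<phi>"
    using E_inf_le(1)[OF \<Omega>, of "ae_eq \<Omega> `` {g}" g \<alpha> L \<phi>] g \<alpha> L holder_on_subset[OF g(1)] by auto
  then show ?thesis by blast
qed

text \<open>Gamma-convergence supplies recovery sequences only for points of the metric space; this
  makes every member of \<open>X_inf\<close> a legitimate competitor there.\<close>

lemma X_inf_subset_Lq:
  assumes \<Omega>: "open \<Omega>" "bounded \<Omega>" and q: "0 < q"
  shows "X_inf \<alpha> \<Omega> \<phi> \<subseteq> Lq q \<Omega>"
proof
  fix U assume "U \<in> X_inf \<alpha> \<Omega> \<phi>"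
  then have U: "U \<in> L0 \<Omega>" and "cont_rep \<Omega> U \<in> cont_reps \<Omega> U"
    by (auto simp: X_inf_def intro: cont_rep_in)
  then have c: "cont_rep \<Omega> U \<in> U" "continuous_on (closure \<Omega>) (cont_rep \<Omega> U)"
    by (auto simp: cont_reps_def)
  have "continuous_on (closure \<Omega>) (\<lambda>x. \<bar>cont_rep \<Omega> U x\<bar> powr q)"
    using c(2) q by (intro continuous_on_powr' continuous_intros) auto
  then have "cont_rep \<Omega> U \<in> Lq_functions q \<Omega>"
    using integrable_continuous_closure[OF \<Omega>] L0_measurable[OF U c(1)] by (simp add: Lq_functions_def)
  then show "U \<in> Lq q \<Omega>"
    using L0_eq_class[OF U c(1)] unfolding Lq_def by (metis quotientI)
qed

lemma limitin_Lq_metric: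
  assumes "1 \<le> q"
  shows "limitin (mtopology_of (Lq_metric q \<Omega>)) s U sequentially \<longleftrightarrow>
    U \<in> Lq q \<Omega> \<and> (\<forall>\<^sub>F n in sequentially. s n \<in> Lq q \<Omega>) \<and> (\<lambda>n. Lq_dist q \<Omega> (s n) U) \<longlonglongrightarrow> 0"
proof -
  interpret Metric_space "Lq q \<Omega>" "Lq_dist q \<Omega>" by (rule Metric_space_Lq[OF assms])
  show ?thesis by (simp add: Lq_metric_def limitin_metric_dist_null)
qed

text \<open>A function with Hoelder constant L has energy at most L times the measure of the domain
  to the power 2/p, and this factor tends to 1 up to the enlargement of the measure in
  \<open>m\<close>.\<close>

lemma limsup_E_p_le_E_inf:
  fixes \<Omega> :: "'a::euclidean_space set"
  assumes \<Omega>: "open \<Omega>" "bounded \<Omega>" and "0 < \<alpha>" and p: "filterlim p at_top sequentially"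
  shows "limsup (\<lambda>n. E_p \<alpha> (p n) \<Omega> \<phi> U) \<le> E_inf \<alpha> \<Omega> \<phi> U"
proof (cases "U \<in> X_inf \<alpha> \<Omega> \<phi>")
  case True
  then have U: "U \<in> L0 \<Omega>" and bv: "has_boundary_values \<Omega> \<phi> U"
    and fin: "holder_seminorm \<alpha> (closure \<Omega>) (cont_rep \<Omega> U) < \<infinity>"
    by (auto simp: X_inf_def)
  let ?c = "cont_rep \<Omega> U"
  have c: "?c \<in> U" using cont_rep_in[OF bv] by (simp add: cont_reps_def)
  obtain L where L: "0 \<le> L" "holder_seminorm \<alpha> (closure \<Omega>) ?c = ennreal L" "holder_on \<alpha> L (closure \<Omega>) ?c"
    using holder_seminorm_finiteE[OF fin] .
  \<comment> \<open>The summand 1 keeps the base positive, so that \<open>m powr (2 / p n)\<close>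
    tends to \<open>m powr 0 = 1\<close>; in HOL \<open>0 powr 0\<close> is 0.\<close>
  define m where "m = measure lebesgue \<Omega> + 1"
  have m: "0 < m" "measure lebesgue \<Omega> \<le> m" by (simp_all add: m_def add_nonneg_pos)
  have bound: "E_p \<alpha> r \<Omega> \<phi> U \<le> ennreal (L * m powr (2 / r))" if r: "0 < r" for r
  proof -
    have "frac_energy \<alpha> r \<Omega> ?c \<le> ennreal (L powr r * (measure lebesgue \<Omega>)\<^sup>2)"
      using \<Omega> L r holder_on_subset[OF L(3) closure_subset] by (intro frac_energy_holder_le) auto
    also have "\<dots> \<le> ennreal (L powr r * m\<^sup>2)"
      using m by (intro ennreal_leI mult_left_mono power_mono) auto
    also have "L powr r * m\<^sup>2 = (L * m powr (2 / r)) powr r"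
      using m r by (simp add: powr_mult powr_powr)
    finally have "frac_energy \<alpha> r \<Omega> ?c \<le> ennreal ((L * m powr (2 / r)) powr r)" .
    then have "frac_seminorm \<alpha> r \<Omega> (rep U) \<le> ennreal (L * m powr (2 / r))"
      unfolding frac_seminorm_rep[OF \<Omega>(1) U c] frac_seminorm_eq_energy[OF \<Omega> L0_measurable[OF U c]]
      using L r by (intro ennreal_root_le) auto
    moreover from this have "U \<in> X_p \<alpha> r \<Omega> \<phi>"
      using U bv by (auto simp: X_p_def intro: order_le_less_trans)
    ultimately show ?thesis by (simp add: E_p_def)
  qed
  have "limsup (\<lambda>n. E_p \<alpha> (p n) \<Omega> \<phi> U) \<le> limsup (\<lambda>n. ennreal (L * m powr (2 / p n)))"
    using filterlim_at_top_dense[THEN iffD1, OF p, rule_format, of 0]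
    by (intro Limsup_mono) (auto elim!: eventually_mono intro: bound)
  also have "\<dots> = ennreal L"
  proof (rule lim_imp_Limsup)
    have "(\<lambda>n. L * m powr (2 / p n)) \<longlonglongrightarrow> L * m powr 0"
      using m p by (intro tendsto_intros tendsto_divide_0[OF tendsto_const] filterlim_at_top_imp_at_infinity) auto
    then show "(\<lambda>n. ennreal (L * m powr (2 / p n))) \<longlonglongrightarrow> ennreal L"
      using m by (intro tendsto_ennrealI) simp
  qed simp
  also have "\<dots> = E_inf \<alpha> \<Omega> \<phi> U" using True L by (simp add: E_inf_def)
  finally show ?thesis .
qed (simp add: E_inf_def)

section \<open>The lower bound\<close>

lemma Lq_tendsto_AE_subseq:
  assumes q: "0 < q" and w: "\<And>k. w k \<in> Lq_functions q \<Omega>" and lim: "(\<lambda>k. Lq_norm q \<Omega> (w k)) \<longlonglongrightarrow> 0"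
  obtains \<tau> :: "nat \<Rightarrow> nat" where "strict_mono \<tau>" "AE x in lebesgue_on \<Omega>. (\<lambda>k. w (\<tau> k) x) \<longlonglongrightarrow> 0"
proof -
  have "(\<lambda>k. Lq_norm q \<Omega> (w k) powr q) \<longlonglongrightarrow> 0 powr q"
    using lim q by (intro tendsto_powr' tendsto_const) (auto simp: Lq_norm_nonneg)
  then have "(\<lambda>k. LINT x|lebesgue_on \<Omega>. norm (\<bar>w k x\<bar> powr q)) \<longlonglongrightarrow> 0"
    using q by (simp add: Lq_functions_norm_powr)
  then obtain \<tau> :: "nat \<Rightarrow> nat" where "strict_mono \<tau>" and
    ae: "AE x in lebesgue_on \<Omega>. (\<lambda>k. \<bar>w (\<tau> k) x\<bar> powr q) \<longlonglongrightarrow> 0"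
    using tendsto_L1_AE_subseq[of "lebesgue_on \<Omega>" "\<lambda>k x. \<bar>w k x\<bar> powr q"] w by (auto simp: Lq_functions_def)
  have "AE x in lebesgue_on \<Omega>. (\<lambda>k. w (\<tau> k) x) \<longlonglongrightarrow> 0"
    using ae
  proof eventually_elim
    case (elim x)
    have "(\<lambda>k. (\<bar>w (\<tau> k) x\<bar> powr q) powr (1 / q)) \<longlonglongrightarrow> 0 powr (1 / q)"
      using elim q by (intro tendsto_powr' tendsto_const) auto
    then show ?case using q by (simp add: powr_powr tendsto_rabs_zero_iff)
  qed
  with \<open>strict_mono \<tau>\<close> show ?thesis by (rule that)
qed

lemma E_inf_le_of_bounded_energies:
  fixes \<Omega> :: "'a::euclidean_space set"
  assumes \<Omega>: "open \<Omega>" "bounded \<Omega>" "lipschitz_boundary \<Omega>" and \<alpha>: "0 < \<alpha>" "\<alpha> \<le> 1" and q: "1 \<le> q"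
    and p: "filterlim p at_top sequentially" and r: "1 \<le> r" "2 * real (DIM('a)) < \<alpha> * r" "\<And>n. r \<le> p n"
    and U: "U \<in> Lq q \<Omega>" "\<And>n. s n \<in> Lq q \<Omega>" and lim: "(\<lambda>n. Lq_dist q \<Omega> (s n) U) \<longlonglongrightarrow> 0"
    and L: "0 < L" and le: "\<And>n. E_p \<alpha> (p n) \<Omega> \<phi> (s n) \<le> ennreal L"
  shows "E_inf \<alpha> \<Omega> \<phi> U \<le> ennreal L"
proof -
  let ?M = "lebesgue_on \<Omega>"
  have U0: "U \<in> L0 \<Omega>" "\<And>n. s n \<in> L0 \<Omega>" using U Lq_subset_L0 by auto
  define c where "c n = cont_rep \<Omega> (s n)" for n
  \<comment> \<open>Outside \<open>X_p\<close> the energy is infinite, so the bound alone supplies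
    continuous representatives with the prescribed boundary values.\<close>
  have X: "s n \<in> X_p \<alpha> (p n) \<Omega> \<phi>" for n
    using le[of n] by (auto simp: E_p_def top_unique split: if_splits)
  then have bv: "has_boundary_values \<Omega> \<phi> (s n)" for n by (auto simp: X_p_def)
  have c: "c n \<in> s n" "continuous_on (closure \<Omega>) (c n)" for n
    using cont_rep_in[OF bv, of n] by (auto simp: c_def cont_reps_def)
  have cb: "c n x = \<phi> x" if "x \<in> frontier \<Omega>" for n x
    using bv[of n] that by (simp add: has_boundary_values_def c_def)
  have cm: "c n \<in> borel_measurable ?M" for n by (rule L0_measurable[OF U0(2) c(1)])
  have energy: "frac_energy \<alpha> (p n) \<Omega> (c n) \<le> ennreal (L powr p n)" for n
  proof (rule ennreal_root_leD)
    show "ennreal_root (p n) (frac_energy \<alpha> (p n) \<Omega> (c n)) \<le> ennreal L"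
      using le[of n] X[of n] unfolding frac_seminorm_eq_energy[OF \<Omega>(1,2) cm, symmetric]
        frac_seminorm_rep[OF \<Omega>(1) U0(2) c(1), symmetric] by (simp add: E_p_def)
  qed (use L r(1) r(3)[of n] in auto)
  define w where "w n x = c n x - rep U x" for n x
  have w: "w n \<in> Lq_functions q \<Omega>" for n
    unfolding w_def using Lq_functions_diff[OF q Lq_member[OF U(2) c(1)] Lq_rep[OF U(1)]] .
  have "(\<lambda>n. Lq_norm q \<Omega> (w n)) \<longlonglongrightarrow> 0"
    using lim Lq_dist_eq[OF U(2,1) c(1) rep_in[OF U0(1)]] by (simp add: w_def[abs_def])
  \<comment> \<open>The subsequence serves the pointwise limit only; the boundary argument below
    uses mean convergence along the whole sequence.\<close>
  then obtain \<tau> :: "nat \<Rightarrow> nat" where \<tau>: "strict_mono \<tau>"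
    and ae: "AE x in ?M. (\<lambda>k. w (\<tau> k) x) \<longlonglongrightarrow> 0"
    using Lq_tendsto_AE_subseq[of q w \<Omega>] w q by auto
  have "AE x in ?M. (\<lambda>k. c (\<tau> k) x) \<longlonglongrightarrow> rep U x"
    using ae by eventually_elim (simp add: w_def LIM_zero_iff)
  then have "AE x in ?M. AE y in ?M. \<bar>rep U x - rep U y\<bar> \<le> L * norm (x - y) powr \<alpha>"
    by (intro AE_holder_quotient_limit[where c = "\<lambda>k. c (\<tau> k)" and p = "\<lambda>k. p (\<tau> k)"]
        \<Omega> \<alpha> L cm energy filterlim_compose[OF p] filterlim_subseq \<tau>)
  then obtain v where v: "holder_on \<alpha> L UNIV v" "AE x in ?M. rep U x = v x"
    using AE_holder_imp_holder_representative[OF \<Omega>(1) \<alpha> L] by blast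
  have vc: "continuous_on S v" for S
    using holder_on_continuous[OF v(1) \<alpha>(1)] continuous_on_subset by blast
  then have "v \<in> borel_measurable ?M"
    using \<Omega> by (intro continuous_imp_measurable_on_sets_lebesgue) auto
  then have vU: "v \<in> U"
    using v(2) L0_measurable[OF U0(1) rep_in[OF U0(1)]]
    by (intro L0_ae_eq_mem[OF U0(1) rep_in[OF U0(1)]]) (simp add: ae_eq_def)
  have L1: "(\<lambda>n. \<integral>\<^sup>+x. ennreal \<bar>c n x - v x\<bar> \<partial>?M) \<longlonglongrightarrow> 0"
  proof (rule tendsto_sandwich[OF _ _ tendsto_const])
    show "\<forall>\<^sub>F n in sequentially. (\<integral>\<^sup>+x. ennreal \<bar>c n x - v x\<bar> \<partial>?M) \<le>
        ennreal (Lq_dist q \<Omega> (s n) U * (measure ?M \<Omega> + 1))"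
      unfolding Lq_dist_eq[OF U(2,1) c(1) vU]
      by (intro always_eventually allI nn_integral_abs_le_Lq_norm \<Omega> q Lq_functions_diff
          Lq_member[OF U(2) c(1)] Lq_member[OF U(1) vU])
    have "(\<lambda>n. Lq_dist q \<Omega> (s n) U * (measure ?M \<Omega> + 1)) \<longlonglongrightarrow> 0 * (measure ?M \<Omega> + 1)"
      by (intro tendsto_intros lim)
    then show "(\<lambda>n. ennreal (Lq_dist q \<Omega> (s n) U * (measure ?M \<Omega> + 1))) \<longlonglongrightarrow> 0"
      using tendsto_ennrealI by fastforce
  qed auto
  have "v x = \<phi> x" if x: "x \<in> frontier \<Omega>" for x
  proof (rule boundary_value_limit[OF \<Omega> x \<alpha>(1) r(1,2) _ c(2) cb[OF x] _ vc L1])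
    show "frac_energy \<alpha> r \<Omega> (c n) \<le> ennreal (L powr r * ((measure lebesgue \<Omega>)\<^sup>2 + 1))" for n
      using r by (intro frac_energy_exponent_le[OF \<Omega>(1,2) cm L _ _ energy]) auto
  qed simp
  then show ?thesis
    using L \<alpha> by (intro E_inf_le(2)[OF \<Omega>(1) U0(1) vU holder_on_subset[OF v(1)]]) auto
qed

text \<open>Any x above the lower limit exceeds the energies infinitely often. Along the
  corresponding subsequence x is a uniform bound, and the exponents still tend to infinity and stay
  above the same \<open>r\<close>.\<close>

lemma E_inf_le_liminf_E_p:
  fixes \<Omega> :: "'a::euclidean_space set"
  assumes \<Omega>: "open \<Omega>" "bounded \<Omega>" "lipschitz_boundary \<Omega>" and \<alpha>: "0 < \<alpha>" "\<alpha> \<le> 1" and q: "1 \<le> q"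
    and p: "filterlim p at_top sequentially" and r: "1 \<le> r" "2 * real (DIM('a)) < \<alpha> * r" "\<And>n. r \<le> p n"
    and U: "U \<in> Lq q \<Omega>" "\<And>n. s n \<in> Lq q \<Omega>" and lim: "(\<lambda>n. Lq_dist q \<Omega> (s n) U) \<longlonglongrightarrow> 0"
  shows "E_inf \<alpha> \<Omega> \<phi> U \<le> liminf (\<lambda>n. E_p \<alpha> (p n) \<Omega> \<phi> (s n))"
proof (rule dense_ge)
  fix x assume x: "liminf (\<lambda>n. E_p \<alpha> (p n) \<Omega> \<phi> (s n)) < x"
  show "E_inf \<alpha> \<Omega> \<phi> U \<le> x"
  proof (cases x rule: ennreal_cases)
    case (real L)
    have "0 < x" using x by (rule order_le_less_trans[rotated]) simp
    then have L: "0 < L" using real by simp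
    have "\<exists>\<^sub>F n in sequentially. E_p \<alpha> (p n) \<Omega> \<phi> (s n) < x"
    proof (rule ccontr)
      assume "\<not> ?thesis"
      then have "\<forall>\<^sub>F n in sequentially. x \<le> E_p \<alpha> (p n) \<Omega> \<phi> (s n)"
        by (simp add: frequently_def not_less)
      then have "x \<le> liminf (\<lambda>n. E_p \<alpha> (p n) \<Omega> \<phi> (s n))" by (rule Liminf_bounded)
      then show False using x by (simp add: leD)
    qed
    then have inf: "infinite {n. E_p \<alpha> (p n) \<Omega> \<phi> (s n) < x}"
      by (simp add: frequently_cofinite[symmetric] cofinite_eq_sequentially)
    define \<sigma> where "\<sigma> = enumerate {n. E_p \<alpha> (p n) \<Omega> \<phi> (s n) < x}"
    have \<sigma>: "strict_mono \<sigma>" "E_p \<alpha> (p (\<sigma> k)) \<Omega> \<phi> (s (\<sigma> k)) < x" for k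
      using strict_mono_enumerate[OF inf] enumerate_in_set[OF inf, of k] by (auto simp: \<sigma>_def)
    have "E_inf \<alpha> \<Omega> \<phi> U \<le> ennreal L"
    proof (rule E_inf_le_of_bounded_energies[OF \<Omega> \<alpha> q _ r(1,2) _ U(1)])
      show "filterlim (\<lambda>k. p (\<sigma> k)) at_top sequentially"
        by (intro filterlim_compose[OF p] filterlim_subseq \<sigma>)
      show "(\<lambda>k. Lq_dist q \<Omega> (s (\<sigma> k)) U) \<longlonglongrightarrow> 0"
        by (intro filterlim_compose[OF lim] filterlim_subseq \<sigma>)
    qed (use r U L \<sigma>(2) real in \<open>auto intro: less_imp_le\<close>)
    then show ?thesis using real by simp
  qed simp
qed

lemma Gamma_converges_E_p:
  fixes \<Omega> :: "'a::euclidean_space set"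
  assumes \<Omega>: "open \<Omega>" "bounded \<Omega>" "lipschitz_boundary \<Omega>" and \<alpha>: "0 < \<alpha>" "\<alpha> \<le> 1" and q: "1 \<le> q"
    and p: "filterlim p at_top sequentially" and r: "1 \<le> r" "2 * real (DIM('a)) < \<alpha> * r" "\<And>n. r \<le> p n"
  shows "Gamma_converges (Lq_metric q \<Omega>) (\<lambda>n. E_p \<alpha> (p n) \<Omega> \<phi>) (E_inf \<alpha> \<Omega> \<phi>)"
  unfolding Gamma_converges_def mspace_Lq_metric[OF q] limitin_Lq_metric[OF q]
proof (intro conjI ballI allI impI)
  fix U s
  assume "U \<in> Lq q \<Omega>" "range s \<subseteq> Lq q \<Omega>"
    "U \<in> Lq q \<Omega> \<and> (\<forall>\<^sub>F n in sequentially. s n \<in> Lq q \<Omega>) \<and> (\<lambda>n. Lq_dist q \<Omega> (s n) U) \<longlonglongrightarrow> 0"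
  then show "E_inf \<alpha> \<Omega> \<phi> U \<le> liminf (\<lambda>n. E_p \<alpha> (p n) \<Omega> \<phi> (s n))"
    by (intro E_inf_le_liminf_E_p[OF assms]) auto
next
  fix U assume U: "U \<in> Lq q \<Omega>"
  then have "Lq_dist q \<Omega> U U = 0"
    using Metric_space.zero[OF Metric_space_Lq[OF q]] by blast
  then show "\<exists>s. range s \<subseteq> Lq q \<Omega> \<and>
      (U \<in> Lq q \<Omega> \<and> (\<forall>\<^sub>F n in sequentially. s n \<in> Lq q \<Omega>) \<and> (\<lambda>n. Lq_dist q \<Omega> (s n) U) \<longlonglongrightarrow> 0) \<and>
      limsup (\<lambda>n. E_p \<alpha> (p n) \<Omega> \<phi> (s n)) \<le> E_inf \<alpha> \<Omega> \<phi> U"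
    using U limsup_E_p_le_E_inf[OF \<Omega>(1,2) \<alpha>(1) p] by (intro exI[of _ "\<lambda>_. U"]) auto
qed

text \<open>The fundamental theorem of Gamma-convergence, with convergence of the minimizers assumed
  instead of derived from compactness: the lower bound at \<open>u\<close>, minimality against a
  recovery sequence of \<open>v\<close>, and the upper bound at \<open>v\<close> form one
  chain.\<close>

lemma Gamma_converges_minimizers:
  assumes \<Gamma>: "Gamma_converges m F E" and us: "\<And>n. is_arg_min (F n) (\<lambda>v. v \<in> mspace m) (us n)"
    and lim: "limitin (mtopology_of m) us u sequentially" and v: "v \<in> mspace m"
  shows "E u \<le> E v"
proof -
  have mem: "range us \<subseteq> mspace m" using us by (auto simp: is_arg_min_def)
  have u: "u \<in> mspace m"
    using limitin_topspace[OF lim] by simp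
  obtain s where s: "range s \<subseteq> mspace m" "limsup (\<lambda>n. F n (s n)) \<le> E v"
    using \<Gamma> v unfolding Gamma_converges_def by blast
  have "E u \<le> liminf (\<lambda>n. F n (us n))"
    using \<Gamma> u mem lim unfolding Gamma_converges_def by blast
  also have "\<dots> \<le> limsup (\<lambda>n. F n (us n))" by (intro Liminf_le_Limsup) simp
  also have "\<dots> \<le> limsup (\<lambda>n. F n (s n))"
    using us s(1) by (intro Limsup_mono always_eventually allI) (auto simp: is_arg_min_linorder image_subset_iff)
  also note s(2)
  finally show ?thesis .
qed

theorem theorem2p4:
  fixes \<Omega> :: "(real ^ 'n) set" and \<phi> :: "real ^ 'n \<Rightarrow> real"
    and \<alpha> q :: real and p :: "nat \<Rightarrow> real"
  assumes "0 < \<alpha>" and "\<alpha> < 1"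
    and "2 * real CARD('n) / \<alpha> < q"
    and "bounded_lipschitz_domain \<Omega>"
    and "\<phi> \<in> holder_space \<alpha> (frontier \<Omega>)"
    and "\<And>n. 2 * real CARD('n) / \<alpha> < p n"
    and "incseq p"
    and "filterlim p at_top sequentially"
  shows "Gamma_converges (Lq_metric q \<Omega>) (\<lambda>n. E_p \<alpha> (p n) \<Omega> \<phi>) (E_inf \<alpha> \<Omega> \<phi>) \<and>
    (\<forall>us u. (\<forall>n. is_arg_min (E_p \<alpha> (p n) \<Omega> \<phi>) (\<lambda>v. v \<in> Lq q \<Omega>) (us n)) \<longrightarrow>
        limitin (mtopology_of (Lq_metric q \<Omega>)) us u sequentially \<longrightarrow>
        Gamma_converges (Lq_metric q \<Omega>) (\<lambda>n. E_p \<alpha> (p n) \<Omega> \<phi>) (E_inf \<alpha> \<Omega> \<phi>) \<longrightarrow>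
        is_arg_min (E_inf \<alpha> \<Omega> \<phi>) (\<lambda>v. v \<in> X_inf \<alpha> \<Omega> \<phi>) u)"
proof (intro conjI allI impI)
  have \<Omega>: "open \<Omega>" "bounded \<Omega>" "lipschitz_boundary \<Omega>"
    using assms(4) by (auto simp: bounded_lipschitz_domain_def)
  have "1 \<le> real CARD('n)" by (simp add: Suc_le_eq)
  then have "\<alpha> \<le> 2 * real CARD('n)" using assms(2) by linarith
  \<comment> \<open>Makes both \<open>q\<close> and the exponents at least 1: the former for the
    triangle inequality in \<open>Lq\<close>, the latter for the power estimates.\<close>
  then have one: "1 \<le> 2 * real CARD('n) / \<alpha>" using assms(1) by (simp add: le_divide_eq)
  have q: "1 \<le> q" using one assms(3) by simp
  \<comment> \<open>The fixed exponent is \<open>p 0\<close>, the smallest one because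
    \<open>p\<close> is increasing.\<close>
  have r: "1 \<le> p 0" using one assms(6)[of 0] by linarith
  have r': "2 * real DIM(real ^ 'n) < \<alpha> * p 0"
    using assms(1) assms(6)[of 0] by (simp add: divide_less_eq mult.commute)
  show "Gamma_converges (Lq_metric q \<Omega>) (\<lambda>n. E_p \<alpha> (p n) \<Omega> \<phi>) (E_inf \<alpha> \<Omega> \<phi>)"
    using assms incseqD[OF assms(7)] by (intro Gamma_converges_E_p[OF \<Omega> _ _ q _ r r']) auto
  fix us u
  assume us: "\<forall>n. is_arg_min (E_p \<alpha> (p n) \<Omega> \<phi>) (\<lambda>v. v \<in> Lq q \<Omega>) (us n)"
    and lim: "limitin (mtopology_of (Lq_metric q \<Omega>)) us u sequentially"
    and \<Gamma>: "Gamma_converges (Lq_metric q \<Omega>) (\<lambda>n. E_p \<alpha> (p n) \<Omega> \<phi>) (E_inf \<alpha> \<Omega> \<phi>)"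
  have min: "E_inf \<alpha> \<Omega> \<phi> u \<le> E_inf \<alpha> \<Omega> \<phi> v" if "v \<in> X_inf \<alpha> \<Omega> \<phi>" for v
    using Gamma_converges_minimizers[OF \<Gamma> _ lim] us subsetD[OF X_inf_subset_Lq[OF \<Omega>(1,2)] that, of q] q
    by (simp add: mspace_Lq_metric)
  \<comment> \<open>Minimality over \<open>X_inf\<close> includes membership of \<open>u\<close>. A
    competitor of finite energy forces \<open>E_inf \<alpha> \<Omega> \<phi> u\<close> to be finite,
    which outside \<open>X_inf\<close> is impossible.\<close>
  obtain v where v: "v \<in> X_inf \<alpha> \<Omega> \<phi>"
    using X_inf_nonempty[OF \<Omega>(1) _ _ assms(5)] assms(1,2) by auto
  then have "E_inf \<alpha> \<Omega> \<phi> v < \<infinity>" by (simp add: E_inf_def X_inf_def)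
  then have "E_inf \<alpha> \<Omega> \<phi> u < \<infinity>" using min[OF v] by (rule order_le_less_trans[rotated])
  then have "u \<in> X_inf \<alpha> \<Omega> \<phi>" by (auto simp: E_inf_def split: if_splits)
  then show "is_arg_min (E_inf \<alpha> \<Omega> \<phi>) (\<lambda>v. v \<in> X_inf \<alpha> \<Omega> \<phi>) u"
    using min by (simp add: is_arg_min_linorder)
qed

end
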